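(* Let $d\ge2$, $\alpha\in(0,1)$, let $m\ge1$ be an integer, let $\Omega$ be a bounded $\mathscr{C}^{1,\alpha}$ domain in $\mathbb{R}^d$ with $\mathbb{R}^d\setminus\overline\Omega$ connected, and let $\Psi:\overline\Omega\to\overline\Omega$ be a $\mathscr{C}^{m+2}$ (resp. $\mathscr{C}^\infty$, or real-analytic) diffeomorphism on $\overline\Omega$ satisfying $\Psi|_{\partial\Omega}=\mathrm{Id}$. Let $\nu$ be the unit outward normal to $\partial\Omega$. Then $$(D\Psi-\mathrm{Id})\,\nu=0\quad\text{at } x_0$$ for every $x_0\in\partial\Omega$ such that $\partial\Omega$ is not $\mathscr{C}^{m,\alpha}$ (resp. $\mathscr{C}^\infty$, or real-analytic) in any neighbourhood of $x_0$.
   Context: $D\Psi$ is the Jacobian matrix of $\Psi$. The three regularity classes are to be read respectively: $\Psi\in\mathscr{C}^{m+2}$ with $\partial\Omega$ not $\mathscr{C}^{m,\alpha}$ near $x_0$; $\Psi\in\mathscr{C}^\infty$ with $\partial\Omega$ not $\mathscr{C}^\infty$ near $x_0$; $\Psi$ real-analytic with $\partial\Omega$ not real-analytic near $x_0$. *)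

theory Defs
  imports "HOL-Analysis.Analysis"
begin

section \<open>Regularity classes on open sets\<close>

text \<open>The partial derivative of \<open>f\<close> along the coordinate directions listed in \<open>ks\<close>;
  its order is \<open>length ks\<close>.\<close>

primrec iter_partial ::
  "'n list \<Rightarrow> (real^'n \<Rightarrow> 'b::real_normed_vector) \<Rightarrow> real^'n \<Rightarrow> 'b"
where
  "iter_partial [] f = f"
| "iter_partial (k # ks) f = (\<lambda>x. frechet_derivative (iter_partial ks f) (at x) (axis k 1))"

text \<open>The regularity classes \<open>Ck_on\<close>, \<open>Cinf_on\<close>, \<open>Ck_holder_on\<close>, \<open>real_analytic_on\<close> are meant
  for open \<open>U\<close>. The values of \<open>f\<close> outside \<open>U\<close>
  play no role.\<close>

definition Ck_on :: "nat \<Rightarrow> (real^'n) set \<Rightarrow> (real^'n \<Rightarrow> 'b::real_normed_vector) \<Rightarrow> bool" where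
  "Ck_on k U f \<longleftrightarrow>
     (\<forall>ks. length ks < k \<longrightarrow> (\<forall>x\<in>U. iter_partial ks f differentiable (at x))) \<and>
     (\<forall>ks. length ks \<le> k \<longrightarrow> continuous_on U (iter_partial ks f))"

definition Cinf_on :: "(real^'n) set \<Rightarrow> (real^'n \<Rightarrow> 'b::real_normed_vector) \<Rightarrow> bool" where
  "Cinf_on U f \<longleftrightarrow> (\<forall>k. Ck_on k U f)"

definition holder_on ::
  "real \<Rightarrow> 'a::metric_space set \<Rightarrow> ('a \<Rightarrow> 'b::metric_space) \<Rightarrow> bool"
where
  "holder_on \<alpha> S f \<longleftrightarrow> (\<exists>C. \<forall>x\<in>S. \<forall>y\<in>S. dist (f x) (f y) \<le> C * dist x y powr \<alpha>)"

definition Ck_holder_on ::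
  "nat \<Rightarrow> real \<Rightarrow> (real^'n) set \<Rightarrow> (real^'n \<Rightarrow> 'b::real_normed_vector) \<Rightarrow> bool"
where
  "Ck_holder_on k \<alpha> U f \<longleftrightarrow>
     Ck_on k U f \<and> (\<forall>ks. length ks = k \<longrightarrow> holder_on \<alpha> U (iter_partial ks f))"

text \<open>Real-analyticity: near every point of \<open>U\<close>, \<open>f\<close> is the sum of a (multivariate) power
  series, with coefficients \<open>c a\<close> indexed by the multi-indices \<open>a\<close>.\<close>

definition real_analytic_on ::
  "(real^'n) set \<Rightarrow> (real^'n \<Rightarrow> 'b::real_normed_vector) \<Rightarrow> bool"
where
  "real_analytic_on U f \<longleftrightarrow>
     (\<forall>x\<in>U. \<exists>r>0. \<exists>c :: ('n \<Rightarrow> nat) \<Rightarrow> 'b. ball x r \<subseteq> U \<and>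
        (\<forall>y\<in>ball x r.
           ((\<lambda>a. (\<Prod>i\<in>UNIV. (y $ i - x $ i) ^ a i) *\<^sub>R c a) has_sum f y) UNIV))"

section \<open>Regularity up to the boundary\<close>

text \<open>\<open>f\<close> is of class \<open>C\<^sup>k\<close> on the closure of the open set \<open>\<Omega>\<close>: \<open>f\<close> is continuous on the
  closure, of class \<open>C\<^sup>k\<close> in \<open>\<Omega>\<close>, and all its partial derivatives of order at most \<open>k\<close>
  extend continuously from \<open>\<Omega>\<close> to the closure. For domains with \<open>C\<^sup>1\<close> boundary this amounts
  to the existence of a \<open>C\<^sup>k\<close> extension to a neighbourhood (Whitney).\<close>

definition Ck_closure ::
  "nat \<Rightarrow> (real^'n) set \<Rightarrow> (real^'n \<Rightarrow> 'b::real_normed_vector) \<Rightarrow> bool"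
where
  "Ck_closure k \<Omega> f \<longleftrightarrow>
     continuous_on (closure \<Omega>) f \<and> Ck_on k \<Omega> f \<and>
     (\<forall>ks. length ks \<le> k \<longrightarrow>
        (\<exists>g. continuous_on (closure \<Omega>) g \<and> (\<forall>x\<in>\<Omega>. g x = iter_partial ks f x)))"

definition Cinf_closure :: "(real^'n) set \<Rightarrow> (real^'n \<Rightarrow> 'b::real_normed_vector) \<Rightarrow> bool" where
  "Cinf_closure \<Omega> f \<longleftrightarrow> (\<forall>k. Ck_closure k \<Omega> f)"

text \<open>Real-analyticity on the closure is existence of real-analytic extensions locally, around
  every point of the closure.\<close>

definition real_analytic_closure ::
  "(real^'n) set \<Rightarrow> (real^'n \<Rightarrow> 'b::real_normed_vector) \<Rightarrow> bool"
where
  "real_analytic_closure \<Omega> f \<longleftrightarrow>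
     (\<forall>x\<in>closure \<Omega>. \<exists>U g. open U \<and> x \<in> U \<and> real_analytic_on U g \<and>
        (\<forall>y\<in>closure \<Omega> \<inter> U. f y = g y))"

text \<open>\<open>R \<Omega> f\<close> states that \<open>f\<close> has the regularity in question on the closure of \<open>\<Omega>\<close>.\<close>

definition diffeo_on_closure ::
  "((real^'n) set \<Rightarrow> (real^'n \<Rightarrow> real^'n) \<Rightarrow> bool) \<Rightarrow>
   (real^'n) set \<Rightarrow> (real^'n \<Rightarrow> real^'n) \<Rightarrow> bool"
where
  "diffeo_on_closure R \<Omega> \<Psi> \<longleftrightarrow>
     bij_betw \<Psi> (closure \<Omega>) (closure \<Omega>) \<and>
     R \<Omega> \<Psi> \<and> R \<Omega> (inv_into (closure \<Omega>) \<Psi>)"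

text \<open>The Jacobian matrix at a point of the closure, in particular at a boundary point: the
  continuous extension of the Jacobian matrix from the open set \<open>\<Omega>\<close>.\<close>

definition closure_jacobian ::
  "(real^'n) set \<Rightarrow> (real^'n \<Rightarrow> real^'n) \<Rightarrow> real^'n \<Rightarrow> real^'n^'n"
where
  "closure_jacobian \<Omega> \<Psi> x = Lim (at x within \<Omega>) (\<lambda>y. jacobian \<Psi> (at y))"

section \<open>Regularity of the boundary\<close>

text \<open>Near \<open>x\<^sub>0\<close>, after a rigid motion, \<open>\<Omega>\<close> is the region strictly below the graph of a function
  \<open>\<phi>\<close> with the regularity \<open>R\<close> (and hence \<open>\<partial>\<Omega>\<close> is that graph). The unit vector \<open>e\<close> is the vertical
  direction. A function of the \<open>d - 1\<close> horizontal variables is encoded as a function \<open>\<phi>\<close> on the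
  whole space that is constant along \<open>e\<close>.\<close>

definition boundary_regular_near ::
  "((real^'n) set \<Rightarrow> (real^'n \<Rightarrow> real) \<Rightarrow> bool) \<Rightarrow> (real^'n) set \<Rightarrow> real^'n \<Rightarrow> bool"
where
  "boundary_regular_near R \<Omega> x0 \<longleftrightarrow>
     (\<exists>U e \<phi>. open U \<and> x0 \<in> U \<and> norm e = 1 \<and>
        (\<forall>x t. \<phi> (x + t *\<^sub>R e) = \<phi> x) \<and> R U \<phi> \<and>
        \<Omega> \<inter> U = {x \<in> U. x \<bullet> e < \<phi> x})"

definition C1_holder_domain :: "real \<Rightarrow> (real^'n) set \<Rightarrow> bool" where
  "C1_holder_domain \<alpha> \<Omega> \<longleftrightarrow>
     open \<Omega> \<and> connected \<Omega> \<and> \<Omega> \<noteq> {} \<and>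
     (\<forall>x\<in>frontier \<Omega>. boundary_regular_near (Ck_holder_on 1 \<alpha>) \<Omega> x)"

text \<open>\<open>n\<close> is the unit outward normal to \<open>\<partial>\<Omega>\<close> at \<open>x\<close>: it is orthogonal to \<open>\<partial>\<Omega>\<close>, in the sense that
  \<open>(y - x) \<bullet> n = o(\<bar>y - x\<bar>)\<close> as \<open>y\<close> tends to \<open>x\<close> in \<open>\<partial>\<Omega>\<close>, and it points out of \<open>\<Omega>\<close>. If \<open>\<Omega>\<close> has
  \<open>C\<^sup>1\<close> boundary and the dimension is at least 2, there is exactly one such vector.\<close>

definition outward_unit_normal :: "(real^'n) set \<Rightarrow> real^'n \<Rightarrow> real^'n \<Rightarrow> bool" where
  "outward_unit_normal \<Omega> x n \<longleftrightarrow>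
     norm n = 1 \<and>
     ((\<lambda>y. ((y - x) \<bullet> n) / norm (y - x)) \<longlongrightarrow> 0) (at x within frontier \<Omega>) \<and>
     (\<forall>\<^sub>F t in at_right 0. x + t *\<^sub>R n \<notin> closure \<Omega>)"

end

theory Submission
  imports Defs
begin

text \<open>Since \<open>\<Psi> = id\<close> on \<open>\<partial>\<Omega>\<close>, every component \<open>F\<close> of \<open>\<Psi> - id\<close> vanishes on the boundary. If
  \<open>D\<Psi> - Id\<close> does not kill some vector at \<open>x\<^sub>0\<close>, one component \<open>F\<close> has \<open>\<nabla>F(x\<^sub>0) \<noteq> 0\<close>, and the boundary near \<open>x\<^sub>0\<close>
  is the zero set of \<open>F\<close>: so it inherits the regularity of \<open>\<Psi>\<close>. No extension of \<open>F\<close> beyond \<open>\<Omega>\<close> is needed for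
  this in the \<open>C\<^sup>k\<close> case. If \<open>\<phi>\<close> is the \<open>C\<^sup>1\<close> function whose graph in direction \<open>e\<close> is the boundary and
  \<open>p\<close> is the vertical projection onto that graph, differentiating \<open>F \<circ> p = 0\<close> gives
  \<open>\<nabla>\<phi> = e - (\<nabla>F \<circ> p) / (e \<bullet> \<nabla>F \<circ> p)\<close>, and the regularity of \<open>\<phi>\<close> can be bootstrapped from this identity.
  In the analytic case \<open>\<phi>\<close> is obtained locally by the iteration \<open>s \<mapsto> s - F(\<cdot>, s) / \<partial>\<^sub>eF\<close>, which contracts
  in the weighted \<open>\<ell>\<^sup>1\<close> norm of the power series coefficients.\<close>

section \<open>Absolutely convergent multivariate power series\<close>

text \<open>Transversality of \<open>F\<close> to \<open>e\<close> has to be proved. Writing w for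
  the gradient of \<open>F\<close>, the differentiated identity is w + (w . e)(grad \<phi> - e) = 0,
  so w . e = 0 would force w = 0. Hence a nonzero gradient at \<open>x0\<close> makes the
  denominator nonzero there, and by continuity nearby. The bootstrap gains one derivative per round
  because \<open>p\<close> is exactly as regular as \<phi>, while the identity expresses the
  gradient of \<phi> algebraically through the gradient of \<open>F\<close> composed with
  \<open>p\<close>. Its obstacle is the chain rule: on the boundary the derivatives of
  \<open>F\<close> exist only as continuous extensions from one side. In the analytic case the graph
  function is given beforehand and is known only to be continuous; what is missing is a power series
  for it. The weighted norm is used because it is submultiplicative and dominates the supremum on a
  box: one contraction estimate makes the iterates converge as power series and, read for constants
  at a fixed point, shows that their limit is the given function.\<close>

definition mon :: "real^'n \<Rightarrow> ('n \<Rightarrow> nat) \<Rightarrow> real" where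
  "mon v a = (\<Prod>i\<in>UNIV. v $ i ^ a i)"

definition deg :: "('n::finite \<Rightarrow> nat) \<Rightarrow> nat" where
  "deg a = (\<Sum>i\<in>UNIV. a i)"

definition has_ps :: "real \<Rightarrow> (('n \<Rightarrow> nat) \<Rightarrow> real) \<Rightarrow> (real^'n \<Rightarrow> real) \<Rightarrow> bool" where
  "has_ps r c f \<longleftrightarrow> (\<lambda>a. \<bar>c a\<bar> * r ^ deg a) summable_on UNIV \<and>
     (\<forall>v. (\<forall>i. \<bar>v $ i\<bar> \<le> r) \<longrightarrow> ((\<lambda>a. c a * mon v a) has_sum f v) UNIV)"

text \<open>\<open>M\<close> bounds the norm of \<open>f\<close> in the Banach algebra of power series with coefficients in the weighted
  \<open>\<ell>\<^sup>1\<close> space of weight \<open>r\<^bsup>|a|\<^esup>\<close>.\<close>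

definition ps_bounded :: "real \<Rightarrow> real \<Rightarrow> (real^'n \<Rightarrow> real) \<Rightarrow> bool" where
  "ps_bounded r M f \<longleftrightarrow> (\<exists>c. has_ps r c f \<and> (\<Sum>\<^sub>\<infinity>a. \<bar>c a\<bar> * r ^ deg a) \<le> M)"

section \<open>Sums, products and compositions in the weighted algebra of power series\<close>

lemma abs_mon_le:
  assumes "\<forall>i. \<bar>v $ i\<bar> \<le> r"
  shows "\<bar>mon v a\<bar> \<le> r ^ deg a"
proof -
  have "\<bar>mon v a\<bar> = (\<Prod>i\<in>UNIV. \<bar>v $ i\<bar> ^ a i)"
    by (simp add: mon_def abs_prod power_abs)
  also have "\<dots> \<le> (\<Prod>i\<in>UNIV. r ^ a i)"
    by (intro prod_mono) (use assms in \<open>auto intro: power_mono\<close>)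
  finally show ?thesis by (simp add: deg_def power_sum)
qed

lemma mon_zero_index [simp]: "mon v (\<lambda>_. 0) = 1"
  by (simp add: mon_def)

lemma mon_Suc: "mon v (a(i := Suc (a i))) = v $ i * mon v a"
proof -
  have "mon v b = v $ i ^ b i * (\<Prod>j\<in>UNIV - {i}. v $ j ^ b j)" for b
    unfolding mon_def by (rule prod.remove) auto
  from this[of "a(i := Suc (a i))"] this[of a] show ?thesis by simp
qed

lemma deg_Suc: "deg ((a :: _::finite \<Rightarrow> _)(i := Suc (a i))) = Suc (deg a)"
proof -
  have "deg b = b i + (\<Sum>j\<in>UNIV - {i}. b j)" for b
    unfolding deg_def by (rule sum.remove) auto
  from this[of "a(i := Suc (a i))"] this[of a] show ?thesis by simp
qed

lemma deg_eq_0_iff: "deg (a :: _::finite \<Rightarrow> _) = 0 \<longleftrightarrow> a = (\<lambda>_. 0)"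
  by (auto simp: deg_def fun_eq_iff)

lemma deg_zero [simp]: "deg (\<lambda>_::_::finite. 0) = 0"
  by (simp add: deg_eq_0_iff)

lemma multi_index_induct [case_names zero Suc]:
  fixes P :: "('n::finite \<Rightarrow> nat) \<Rightarrow> bool"
  assumes "P (\<lambda>_. 0)" and "\<And>a i. P a \<Longrightarrow> P (a(i := Suc (a i)))"
  shows "P a"
proof (induction "deg a" arbitrary: a)
  case 0
  then show ?case using assms(1) deg_eq_0_iff[of a] by simp
next
  case (Suc n)
  then obtain i where i: "a i \<noteq> 0" by (force simp: deg_def)
  define b where "b = a(i := a i - 1)"
  have a: "a = b(i := Suc (b i))" using i by (auto simp: b_def)
  then have "deg b = n" using Suc.hyps(2) deg_Suc[of b i] by simp
  then show ?case using Suc.hyps(1)[of b] assms(2)[of b i] a by simp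
qed

lemma ps_bounded_mono:
  assumes "ps_bounded r M f" "M \<le> N"
  shows "ps_bounded r N f"
  using assms unfolding ps_bounded_def has_ps_def by (meson order_trans)

lemma ps_bounded_nonneg:
  fixes f :: "real^'n \<Rightarrow> real"
  assumes "ps_bounded r M f" "0 \<le> r"
  shows "0 \<le> M"
proof -
  from assms obtain c :: "('n \<Rightarrow> nat) \<Rightarrow> real" where "(\<Sum>\<^sub>\<infinity>a. \<bar>c a\<bar> * r ^ deg a) \<le> M"
    unfolding ps_bounded_def has_ps_def by blast
  moreover have "0 \<le> (\<Sum>\<^sub>\<infinity>a. \<bar>c a\<bar> * r ^ deg a)"
    by (rule infsum_nonneg) (use assms in simp)
  ultimately show ?thesis by simp
qed

lemma ps_bounded_cong:
  assumes "ps_bounded r M f" and eq: "\<And>v. (\<forall>i. \<bar>v $ i\<bar> \<le> r) \<Longrightarrow> f v = g v"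
  shows "ps_bounded r M g"
proof -
  from assms(1) obtain c where c: "(\<lambda>a. \<bar>c a\<bar> * r ^ deg a) summable_on UNIV"
     "(\<Sum>\<^sub>\<infinity>a. \<bar>c a\<bar> * r ^ deg a) \<le> M"
     "\<And>v. (\<forall>i. \<bar>v $ i\<bar> \<le> r) \<Longrightarrow> ((\<lambda>a. c a * mon v a) has_sum f v) UNIV"
    unfolding ps_bounded_def has_ps_def by blast
  then show ?thesis unfolding ps_bounded_def has_ps_def using eq by (intro exI[of _ c]) simp
qed

lemma ps_bounded_abs_le:
  assumes "ps_bounded r M f" "\<forall>i. \<bar>v $ i\<bar> \<le> r"
  shows "\<bar>f v\<bar> \<le> M"
proof -
  from assms obtain c where c: "(\<lambda>a. \<bar>c a\<bar> * r ^ deg a) summable_on UNIV"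
     "(\<Sum>\<^sub>\<infinity>a. \<bar>c a\<bar> * r ^ deg a) \<le> M"
     "((\<lambda>a. c a * mon v a) has_sum f v) UNIV"
    unfolding ps_bounded_def has_ps_def by blast
  have le: "\<bar>c a * mon v a\<bar> \<le> \<bar>c a\<bar> * r ^ deg a" for a
    using abs_mon_le[OF assms(2)] by (simp add: abs_mult mult_left_mono)
  have sm: "(\<lambda>a. norm (c a * mon v a)) summable_on UNIV"
    by (rule summable_on_comparison_test[OF c(1)]) (use le in auto)
  have "norm (f v) \<le> (\<Sum>\<^sub>\<infinity>a. norm (c a * mon v a))"
    by (rule norm_has_sum_bound[OF has_sum_infsum[OF sm] c(3)])
  also have "\<dots> \<le> (\<Sum>\<^sub>\<infinity>a. \<bar>c a\<bar> * r ^ deg a)"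
    using infsum_mono[OF sm c(1)] le by auto
  finally show ?thesis using c(2) by simp
qed

lemma ps_bounded_const: "ps_bounded r \<bar>k\<bar> (\<lambda>_. k)"
proof -
  let ?c = "\<lambda>a. if a = (\<lambda>_. 0) then k else 0"
  have 1: "((\<lambda>a. \<bar>?c a\<bar> * r ^ deg a) has_sum \<bar>k\<bar>) UNIV"
    by (rule has_sum_finite_neutralI[of "{\<lambda>_. 0}"]) auto
  have 2: "((\<lambda>a. ?c a * mon v a) has_sum k) UNIV" for v
    by (rule has_sum_finite_neutralI[of "{\<lambda>_. 0}"]) auto
  show ?thesis
    unfolding ps_bounded_def has_ps_def using 1 2
    by (intro exI[of _ ?c]) (auto simp: has_sum_iff)
qed

text \<open>Multiplying by a coordinate moves every coefficient along the injective shift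
  \<open>h\<close> of multi-indices and raises each degree by one, so the norm is multiplied by
  exactly \<open>r\<close>.\<close>

lemma ps_bounded_coord_mult:
  fixes i :: "'n::finite"
  assumes "ps_bounded r M f" "0 \<le> r"
  shows "ps_bounded r (r * M) (\<lambda>v. v $ i * f v)"
proof -
  from assms obtain c where c: "(\<lambda>a. \<bar>c a\<bar> * r ^ deg a) summable_on UNIV"
     "(\<Sum>\<^sub>\<infinity>a. \<bar>c a\<bar> * r ^ deg a) \<le> M"
     "\<And>v. (\<forall>i. \<bar>v $ i\<bar> \<le> r) \<Longrightarrow> ((\<lambda>a. c a * mon v a) has_sum f v) UNIV"
    unfolding ps_bounded_def has_ps_def by blast
  define h where "h = (\<lambda>a::'n \<Rightarrow> nat. a(i := Suc (a i)))"
  have inj: "inj h"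
  proof (rule injI)
    fix a b assume "h a = h b"
    then show "a = b" unfolding h_def
      by (metis fun_upd_eqD fun_upd_triv fun_upd_upd nat.inject)
  qed
  define d where "d = (\<lambda>a. if a \<in> range h then c (inv h a) else 0)"
  have dh: "d (h a) = c a" for a
    unfolding d_def using inj by simp
  have transfer: "(g has_sum x) UNIV \<longleftrightarrow> ((\<lambda>a. g (h a)) has_sum x) UNIV"
    if "\<And>a. a \<notin> range h \<Longrightarrow> g a = 0" for g :: "('n \<Rightarrow> nat) \<Rightarrow> real" and x
  proof -
    have "(g has_sum x) UNIV \<longleftrightarrow> (g has_sum x) (range h)"
      by (rule has_sum_cong_neutral) (use that in auto)
    then show ?thesis using has_sum_reindex[OF inj] by (simp add: o_def)
  qed
  have "((\<lambda>a. r * (\<bar>c a\<bar> * r ^ deg a)) has_sum (r * (\<Sum>\<^sub>\<infinity>a. \<bar>c a\<bar> * r ^ deg a))) UNIV"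
    by (intro has_sum_cmult_right has_sum_infsum c)
  then have 1: "((\<lambda>a. \<bar>d a\<bar> * r ^ deg a) has_sum (r * (\<Sum>\<^sub>\<infinity>a. \<bar>c a\<bar> * r ^ deg a))) UNIV"
    by (subst transfer) (auto simp: dh, auto simp: d_def h_def deg_Suc mult_ac)
  have 2: "((\<lambda>a. d a * mon v a) has_sum (v $ i * f v)) UNIV" if "\<forall>i. \<bar>v $ i\<bar> \<le> r" for v
    using has_sum_cmult_right[OF c(3)[OF that], of "v $ i"]
    by (subst transfer) (auto simp: dh, auto simp: d_def h_def mon_Suc mult_ac)
  have "r * (\<Sum>\<^sub>\<infinity>a. \<bar>c a\<bar> * r ^ deg a) \<le> r * M"
    using c(2) assms(2) by (rule mult_left_mono)
  then show ?thesis unfolding ps_bounded_def has_ps_def using 1 2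
    by (intro exI[of _ d]) (auto simp: has_sum_iff)
qed

text \<open>Completeness of the algebra. The double family of coefficients is absolutely summable
  with weights, so the order of summation over \<open>k\<close> and over multi-indices can be
  exchanged, both for the norms and for the values. Sums, products, compositions and limits of
  iterations are all obtained from this.\<close>

lemma ps_bounded_infsum:
  fixes f :: "'k \<Rightarrow> real^'n \<Rightarrow> real"
  assumes f: "\<And>k. ps_bounded r (M k) (f k)" and M: "M summable_on UNIV" and r: "0 < r"
    and F: "\<And>v. (\<forall>i. \<bar>v $ i\<bar> \<le> r) \<Longrightarrow> ((\<lambda>k. f k v) has_sum F v) UNIV"
  shows "ps_bounded r (\<Sum>\<^sub>\<infinity>k. M k) F"
proof -
  define coeffs where "coeffs k c \<longleftrightarrow> (\<lambda>a. \<bar>c a\<bar> * r ^ deg a) summable_on UNIV \<and>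
     (\<Sum>\<^sub>\<infinity>a. \<bar>c a\<bar> * r ^ deg a) \<le> M k \<and>
     (\<forall>v. (\<forall>i. \<bar>v $ i\<bar> \<le> r) \<longrightarrow> ((\<lambda>a. c a * mon v a) has_sum f k v) UNIV)" for k c
  from f have "\<forall>k. \<exists>c. coeffs k c"
    unfolding ps_bounded_def has_ps_def coeffs_def by blast
  then obtain c where "\<forall>k. coeffs k (c k)" using choice by blast
  then have c: "\<And>k. (\<lambda>a. \<bar>c k a\<bar> * r ^ deg a) summable_on UNIV"
     "\<And>k. (\<Sum>\<^sub>\<infinity>a. \<bar>c k a\<bar> * r ^ deg a) \<le> M k"
     "\<And>k v. (\<forall>i. \<bar>v $ i\<bar> \<le> r) \<Longrightarrow> ((\<lambda>a. c k a * mon v a) has_sum f k v) UNIV"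
    unfolding coeffs_def by auto
  define N where "N k = (\<Sum>\<^sub>\<infinity>a. \<bar>c k a\<bar> * r ^ deg a)" for k
  have N0: "0 \<le> N k" for k unfolding N_def by (rule infsum_nonneg) (use r in simp)
  have Nsum: "N summable_on UNIV"
    by (rule summable_on_comparison_test[OF M]) (use c(2) N0 in \<open>auto simp: N_def\<close>)
  have S: "(\<lambda>(k,a). \<bar>c k a\<bar> * r ^ deg a) summable_on UNIV \<times> UNIV"
    by (rule summable_on_SigmaI[where g=N]) (use c(1) r Nsum in \<open>auto simp: N_def\<close>)
  have tot: "((\<lambda>(k,a). \<bar>c k a\<bar> * r ^ deg a) has_sum (\<Sum>\<^sub>\<infinity>k. N k)) (UNIV \<times> UNIV)"
  proof (rule has_sum_SigmaI[where g=N, OF _ has_sum_infsum[OF Nsum] S])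
    show "((\<lambda>a. (\<lambda>(k,a). \<bar>c k a\<bar> * r ^ deg a) (k, a)) has_sum N k) UNIV" for k
      using has_sum_infsum[OF c(1)[of k]] by (simp add: N_def)
  qed
  have tot': "((\<lambda>(a,k). \<bar>c k a\<bar> * r ^ deg a) has_sum (\<Sum>\<^sub>\<infinity>k. N k)) (UNIV \<times> UNIV)"
    using has_sum_swap[where f="\<lambda>(k,a). \<bar>c k a\<bar> * r ^ deg a" and A=UNIV and B=UNIV] tot by simp
  then have S': "(\<lambda>(a,k). \<bar>c k a\<bar> * r ^ deg a) summable_on UNIV \<times> UNIV"
    by (rule has_sum_imp_summable)
  have inner: "(\<lambda>k. \<bar>c k a\<bar> * r ^ deg a) summable_on UNIV" for a
    using summable_on_SigmaD1[OF S', of a] by simp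
  define Q where "Q a = (\<Sum>\<^sub>\<infinity>k. \<bar>c k a\<bar> * r ^ deg a)" for a
  have Q: "(Q has_sum (\<Sum>\<^sub>\<infinity>k. N k)) UNIV"
  proof (rule has_sum_SigmaD[OF tot'])
    show "((\<lambda>k. (\<lambda>(a,k). \<bar>c k a\<bar> * r ^ deg a) (a, k)) has_sum Q a) UNIV" for a
      using has_sum_infsum[OF inner[of a]] by (simp add: Q_def)
  qed
  have ck: "(\<lambda>k. norm (c k a)) summable_on UNIV" for a
  proof -
    have "(\<lambda>k. (\<bar>c k a\<bar> * r ^ deg a) * (1 / r ^ deg a)) summable_on UNIV"
      by (rule summable_on_cmult_left[OF inner])
    then show ?thesis using r by simp
  qed
  define C where "C a = (\<Sum>\<^sub>\<infinity>k. c k a)" for a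
  have Csum: "((\<lambda>k. c k a) has_sum C a) UNIV" for a
    unfolding C_def by (rule has_sum_infsum[OF abs_summable_summable[OF ck]])
  have CQ: "\<bar>C a\<bar> * r ^ deg a \<le> Q a" for a
  proof -
    have "norm (C a) \<le> (\<Sum>\<^sub>\<infinity>k. norm (c k a))"
      by (rule norm_has_sum_bound[OF has_sum_infsum[OF ck] Csum])
    then have "\<bar>C a\<bar> * r ^ deg a \<le> (\<Sum>\<^sub>\<infinity>k. norm (c k a)) * r ^ deg a"
      using r by (intro mult_right_mono) auto
    also have "\<dots> = Q a"
      unfolding Q_def using infsum_cmult_left[of "r ^ deg a" "\<lambda>k. norm (c k a)" UNIV] ck by simp
    finally show ?thesis .
  qed
  have 1: "(\<lambda>a. \<bar>C a\<bar> * r ^ deg a) summable_on UNIV"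
    by (rule summable_on_comparison_test[OF has_sum_imp_summable[OF Q]]) (use CQ r in auto)
  have "(\<Sum>\<^sub>\<infinity>a. \<bar>C a\<bar> * r ^ deg a) \<le> (\<Sum>\<^sub>\<infinity>k. N k)"
    using has_sum_mono[OF has_sum_infsum[OF 1] Q] CQ by simp
  also have "\<dots> \<le> (\<Sum>\<^sub>\<infinity>k. M k)"
    by (rule infsum_mono[OF Nsum M]) (use c(2) in \<open>simp add: N_def\<close>)
  finally have 2: "(\<Sum>\<^sub>\<infinity>a. \<bar>C a\<bar> * r ^ deg a) \<le> (\<Sum>\<^sub>\<infinity>k. M k)" .
  have 3: "((\<lambda>a. C a * mon v a) has_sum F v) UNIV" if v: "\<forall>i. \<bar>v $ i\<bar> \<le> r" for v
  proof -
    have "(\<lambda>p. norm ((\<lambda>(k,a). c k a * mon v a) p)) summable_on UNIV \<times> UNIV"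
      by (rule summable_on_comparison_test[OF S])
        (auto simp: abs_mult intro!: mult_left_mono abs_mon_le v)
    then have "(\<lambda>(k,a). c k a * mon v a) summable_on UNIV \<times> UNIV"
      by (rule abs_summable_summable)
    then have "((\<lambda>(k,a). c k a * mon v a) has_sum F v) (UNIV \<times> UNIV)"
      by (intro has_sum_SigmaI[where g="\<lambda>k. f k v"]) (use c(3) v F in auto)
    then have "((\<lambda>(a,k). c k a * mon v a) has_sum F v) (UNIV \<times> UNIV)"
      using has_sum_swap[where f="\<lambda>(k,a). c k a * mon v a" and A=UNIV and B=UNIV] by simp
    then show ?thesis
      by (rule has_sum_SigmaD) (auto intro!: has_sum_cmult_left Csum)
  qed
  show ?thesis unfolding ps_bounded_def has_ps_def using 1 2 3 by blast
qed

lemma ps_bounded_scale: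
  assumes "ps_bounded r M f"
  shows "ps_bounded r (\<bar>k\<bar> * M) (\<lambda>v. k * f v)"
proof -
  from assms obtain c where c: "(\<lambda>a. \<bar>c a\<bar> * r ^ deg a) summable_on UNIV"
     "(\<Sum>\<^sub>\<infinity>a. \<bar>c a\<bar> * r ^ deg a) \<le> M"
     "\<And>v. (\<forall>i. \<bar>v $ i\<bar> \<le> r) \<Longrightarrow> ((\<lambda>a. c a * mon v a) has_sum f v) UNIV"
    unfolding ps_bounded_def has_ps_def by blast
  have "((\<lambda>a. \<bar>k\<bar> * (\<bar>c a\<bar> * r ^ deg a)) has_sum (\<bar>k\<bar> * (\<Sum>\<^sub>\<infinity>a. \<bar>c a\<bar> * r ^ deg a))) UNIV"
    by (intro has_sum_cmult_right has_sum_infsum c)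
  moreover have "((\<lambda>a. k * (c a * mon v a)) has_sum k * f v) UNIV" if "\<forall>i. \<bar>v $ i\<bar> \<le> r" for v
    by (intro has_sum_cmult_right c(3) that)
  moreover have "\<bar>k\<bar> * (\<Sum>\<^sub>\<infinity>a. \<bar>c a\<bar> * r ^ deg a) \<le> \<bar>k\<bar> * M"
    using c(2) by (rule mult_left_mono) simp
  ultimately show ?thesis unfolding ps_bounded_def has_ps_def
    by (intro exI[of _ "\<lambda>a. k * c a"]) (auto simp: has_sum_iff abs_mult mult.assoc)
qed

lemma ps_bounded_add:
  assumes "ps_bounded r M f" "ps_bounded r N g" "0 < r"
  shows "ps_bounded r (M + N) (\<lambda>v. f v + g v)"
proof -
  have "ps_bounded r (\<Sum>\<^sub>\<infinity>b. if b then M else N) (\<lambda>v. f v + g v)"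
  proof (rule ps_bounded_infsum[where f="\<lambda>b. if b then f else g"])
    show "((\<lambda>b. (if b then f else g) v) has_sum f v + g v) UNIV" for v
      by (rule has_sum_finite_neutralI[of UNIV]) (auto simp: UNIV_bool)
  qed (use assms in auto)
  then show ?thesis by (simp add: UNIV_bool add.commute)
qed

lemma ps_bounded_diff:
  assumes "ps_bounded r M f" "ps_bounded r N g" "0 < r"
  shows "ps_bounded r (M + N) (\<lambda>v. f v - g v)"
  using ps_bounded_add[OF assms(1) ps_bounded_scale[OF assms(2), of "-1"] assms(3)] by simp

lemma ps_bounded_sum:
  assumes "finite I" "\<And>i. i \<in> I \<Longrightarrow> ps_bounded r (M i) (f i)" "0 < r"
  shows "ps_bounded r (\<Sum>i\<in>I. M i) (\<lambda>v. \<Sum>i\<in>I. f i v)"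
  using assms
  by (induction I rule: finite_induct)
     (use ps_bounded_const[of r 0] in \<open>auto intro: ps_bounded_add\<close>)

lemma ps_bounded_mon_mult:
  assumes "ps_bounded r M f" "0 \<le> r"
  shows "ps_bounded r (r ^ deg a * M) (\<lambda>v. mon v a * f v)"
proof (induction a rule: multi_index_induct)
  case zero
  then show ?case using assms by simp
next
  case (Suc a i)
  from ps_bounded_coord_mult[OF Suc assms(2), of i] show ?case
    by (simp only: mon_Suc deg_Suc power_Suc mult_ac)
qed

lemma ps_bounded_coord:
  assumes "0 \<le> r"
  shows "ps_bounded r r (\<lambda>v. v $ i)"
  using ps_bounded_coord_mult[OF ps_bounded_const[of r 1] assms] by simp

text \<open>Expanding only \<open>f\<close> writes the product as a sum of scaled monomials times
  \<open>g\<close>, to which the infinite-sum rule applies; the Cauchy product of coefficients never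
  has to be formed.\<close>

lemma ps_bounded_mult:
  assumes f: "ps_bounded r M f" and g: "ps_bounded r N g" and r: "0 < r"
  shows "ps_bounded r (M * N) (\<lambda>v. f v * g v)"
proof -
  from f obtain c where c: "(\<lambda>a. \<bar>c a\<bar> * r ^ deg a) summable_on UNIV"
     "(\<Sum>\<^sub>\<infinity>a. \<bar>c a\<bar> * r ^ deg a) \<le> M"
     "\<And>v. (\<forall>i. \<bar>v $ i\<bar> \<le> r) \<Longrightarrow> ((\<lambda>a. c a * mon v a) has_sum f v) UNIV"
    unfolding ps_bounded_def has_ps_def by blast
  have "ps_bounded r (\<Sum>\<^sub>\<infinity>a. (\<bar>c a\<bar> * r ^ deg a) * N) (\<lambda>v. f v * g v)"
  proof (rule ps_bounded_infsum)
    show "ps_bounded r ((\<bar>c a\<bar> * r ^ deg a) * N) (\<lambda>v. c a * (mon v a * g v))" for a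
      using ps_bounded_scale[OF ps_bounded_mon_mult[OF g], of "c a" a] r by (simp add: mult_ac)
    show "(\<lambda>a. (\<bar>c a\<bar> * r ^ deg a) * N) summable_on UNIV"
      by (intro summable_on_cmult_left c)
    show "((\<lambda>a. c a * (mon v a * g v)) has_sum f v * g v) UNIV" if "\<forall>i. \<bar>v $ i\<bar> \<le> r" for v
      using has_sum_cmult_left[OF c(3)[OF that], of "g v"] by (simp add: mult_ac)
  qed fact
  moreover have "(\<Sum>\<^sub>\<infinity>a. (\<bar>c a\<bar> * r ^ deg a) * N) = (\<Sum>\<^sub>\<infinity>a. \<bar>c a\<bar> * r ^ deg a) * N"
    by (intro infsum_cmult_left c)
  moreover have "\<dots> \<le> M * N"
    using c(2) ps_bounded_nonneg[OF g] r by (intro mult_right_mono) auto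
  ultimately show ?thesis using ps_bounded_mono by metis
qed

lemma ps_bounded_mon:
  assumes "\<And>i. ps_bounded r \<rho> (\<lambda>v. z v $ i)" "0 < r"
  shows "ps_bounded r (\<rho> ^ deg a) (\<lambda>v. mon (z v) a)"
proof (induction a rule: multi_index_induct)
  case zero
  then show ?case using ps_bounded_const[of r 1] by simp
next
  case (Suc a i)
  from ps_bounded_mult[OF assms(1)[of i] Suc assms(2)] show ?case
    by (simp only: mon_Suc deg_Suc power_Suc)
qed

text \<open>Induction on the multi-index through the splitting z_i z^a - w_i w^a = z_i (z^a - w^a) +
  (z_i - w_i) w^a. The bound is the derivative of \<rho>^|a| times \<delta>; dividing by \<rho>
  instead of lowering the exponent avoids truncated subtraction in degree 0.\<close>

lemma ps_bounded_mon_diff: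
  assumes z: "\<And>i. ps_bounded r \<rho> (\<lambda>v. z v $ i)" and w: "\<And>i. ps_bounded r \<rho> (\<lambda>v. w v $ i)"
    and d: "\<And>i. ps_bounded r \<delta> (\<lambda>v. z v $ i - w v $ i)" and r: "0 < r" and \<rho>: "0 < \<rho>"
  shows "ps_bounded r (real (deg a) * \<rho> ^ deg a / \<rho> * \<delta>) (\<lambda>v. mon (z v) a - mon (w v) a)"
proof (induction a rule: multi_index_induct)
  case zero
  then show ?case using ps_bounded_const[of r 0] by simp
next
  case (Suc a i)
  have "ps_bounded r (\<rho> * (real (deg a) * \<rho> ^ deg a / \<rho> * \<delta>) + \<delta> * \<rho> ^ deg a)
     (\<lambda>v. z v $ i * (mon (z v) a - mon (w v) a) + (z v $ i - w v $ i) * mon (w v) a)"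
    by (intro ps_bounded_add ps_bounded_mult z d Suc ps_bounded_mon w r)
  moreover have "\<rho> * (real (deg a) * \<rho> ^ deg a / \<rho> * \<delta>) + \<delta> * \<rho> ^ deg a
      = real (Suc (deg a)) * \<rho> ^ Suc (deg a) / \<rho> * \<delta>"
    using \<rho> by (simp add: field_simps)
  ultimately show ?case unfolding mon_Suc deg_Suc
    by (simp add: algebra_simps del: of_nat_Suc power_Suc)
qed

lemma ps_bounded_compose:
  assumes "ps_bounded R M f" "\<And>i. ps_bounded r R (\<lambda>v. z v $ i)" "0 < r" "0 \<le> R"
  shows "ps_bounded r M (\<lambda>v. f (z v))"
proof -
  from assms obtain c where c: "(\<lambda>a. \<bar>c a\<bar> * R ^ deg a) summable_on UNIV"
     "(\<Sum>\<^sub>\<infinity>a. \<bar>c a\<bar> * R ^ deg a) \<le> M"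
     "\<And>v. (\<forall>i. \<bar>v $ i\<bar> \<le> R) \<Longrightarrow> ((\<lambda>a. c a * mon v a) has_sum f v) UNIV"
    unfolding ps_bounded_def has_ps_def by blast
  have "ps_bounded r (\<Sum>\<^sub>\<infinity>a. \<bar>c a\<bar> * R ^ deg a) (\<lambda>v. f (z v))"
  proof (rule ps_bounded_infsum)
    show "ps_bounded r (\<bar>c a\<bar> * R ^ deg a) (\<lambda>v. c a * mon (z v) a)" for a
      by (intro ps_bounded_scale ps_bounded_mon assms)
    show "((\<lambda>a. c a * mon (z v) a) has_sum f (z v)) UNIV" if "\<forall>i. \<bar>v $ i\<bar> \<le> r" for v
      by (intro c(3) allI ps_bounded_abs_le[OF assms(2) that])
  qed (use c assms in auto)
  then show ?thesis using c(2) ps_bounded_mono by blast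
qed

section \<open>Low-order terms of a power series and estimates for the remainder\<close>

definition unit_index :: "'n \<Rightarrow> 'n \<Rightarrow> nat" where
  "unit_index i = (\<lambda>_. 0)(i := Suc 0)"

lemma deg_unit_index [simp]: "deg (unit_index (i::'n::finite)) = 1"
  using deg_Suc[of "\<lambda>_. 0" i] by (simp add: unit_index_def)

lemma mon_unit_index [simp]: "mon v (unit_index i) = v $ i"
  using mon_Suc[of v "\<lambda>_. 0" i] by (simp add: unit_index_def)

lemma deg_le_1: "{a :: 'n::finite \<Rightarrow> nat. deg a \<le> 1} = insert (\<lambda>_. 0) (range unit_index)"
proof -
  have "a = (\<lambda>_. 0) \<or> a \<in> range unit_index" if "deg a \<le> 1" for a :: "'n \<Rightarrow> nat"
    using that
  proof (induction a rule: multi_index_induct)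
    case (Suc a i)
    then have "deg a = 0" unfolding deg_Suc by simp
    then have "a = (\<lambda>_. 0)" by (simp add: deg_eq_0_iff)
    then show ?case by (auto simp: unit_index_def)
  qed simp
  then show ?thesis by auto
qed

lemma sum_deg_le_1:
  fixes g :: "('n::finite \<Rightarrow> nat) \<Rightarrow> real"
  shows "(\<Sum>a | deg a \<le> 1. g a) = g (\<lambda>_. 0) + (\<Sum>i\<in>UNIV. g (unit_index i))"
proof -
  have inj: "inj (unit_index :: 'n \<Rightarrow> _)"
    by (rule injI) (metis fun_upd_apply unit_index_def zero_neq_one One_nat_def)
  have "(\<lambda>_. 0) \<notin> range (unit_index :: 'n \<Rightarrow> _)"
  proof
    assume "(\<lambda>_. 0) \<in> range (unit_index :: 'n \<Rightarrow> _)"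
    then obtain i :: 'n where "(\<lambda>_. 0) = unit_index i" by auto
    then have "deg (\<lambda>_::'n. 0) = 1" by simp
    then show False by simp
  qed
  then show ?thesis
    unfolding deg_le_1 using sum.reindex[OF inj, of g] by simp
qed

text \<open>From n = 2 on the sequence n \<theta>^n does not increase when \<theta> is at most 1/2,
  since (n + 1)/2 \<le> n. This is the source of the condition \<open>2 * \<rho> \<le> R\<close> in
  the estimates below.\<close>

lemma real_mult_power_le:
  fixes \<theta> :: real
  assumes "2 \<le> n" "0 \<le> \<theta>" "\<theta> \<le> 1/2"
  shows "real n * \<theta> ^ n \<le> 2 * \<theta>\<^sup>2"
  using assms(1)
proof (induction n rule: dec_induct)
  case (step n)
  have "real (Suc n) * \<theta> \<le> real (Suc n) * (1/2)"
    using assms by (intro mult_left_mono) auto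
  also have "\<dots> \<le> real n" using step by simp
  finally have "(real (Suc n) * \<theta>) * \<theta> ^ n \<le> real n * \<theta> ^ n"
    using assms by (intro mult_right_mono) auto
  then show ?case using step by (simp add: mult.assoc)
qed simp

lemma has_sum_diff:
  fixes f g :: "'k \<Rightarrow> 'b::real_normed_vector"
  assumes "(f has_sum x) A" "(g has_sum y) A"
  shows "((\<lambda>a. f a - g a) has_sum (x - y)) A"
proof -
  have "((\<lambda>a. - g a) has_sum (- y)) A" using assms(2) by (simp add: has_sum_uminus)
  from has_sum_add[OF assms(1) this] show ?thesis by simp
qed

text \<open>After removal of the linear part only degrees at least 2 remain, and there |a|
  \<rho>^(|a|-1) \<le> 2 \<rho> R^(|a|-2). So the remainder is Lipschitz in the inner map with a
  constant proportional to \<rho>, which can be made as small as a contraction argument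
  requires.\<close>

lemma ps_bounded_diff_linear:
  assumes c: "has_ps R c f" and R: "0 < R" and r: "0 < r" and \<rho>: "0 < \<rho>" "2 * \<rho> \<le> R"
    and z: "\<And>i. ps_bounded r \<rho> (\<lambda>v. z v $ i)" and w: "\<And>i. ps_bounded r \<rho> (\<lambda>v. w v $ i)"
    and d: "\<And>i. ps_bounded r \<delta> (\<lambda>v. z v $ i - w v $ i)"
  shows "ps_bounded r (2 * \<rho> * (\<Sum>\<^sub>\<infinity>a. \<bar>c a\<bar> * R ^ deg a) / R\<^sup>2 * \<delta>)
     (\<lambda>v. f (z v) - f (w v) - (\<Sum>i\<in>UNIV. c (unit_index i) * (z v $ i - w v $ i)))"
proof -
  have \<delta>: "0 \<le> \<delta>" using ps_bounded_nonneg[OF d] r by simp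
  \<comment> \<open>Degree 0 cancels in the difference and degree 1 is the subtracted linear part,
    hence the zeros.\<close>
  define M where "M a = (if deg a \<le> 1 then 0 else \<bar>c a\<bar> * (real (deg a) * \<rho> ^ deg a / \<rho> * \<delta>))" for a
  define q where "q a v = (if deg a \<le> 1 then 0 else c a * (mon (z v) a - mon (w v) a))" for a v
  define K where "K = 2 * \<rho> / R\<^sup>2 * \<delta>"
  have Mle: "M a \<le> (\<bar>c a\<bar> * R ^ deg a) * K" for a
  proof (cases "deg a \<le> 1")
    case True
    then show ?thesis using R \<rho> \<delta> by (simp add: M_def K_def)
  next
    case False
    then have "real (deg a) * (\<rho> / R) ^ deg a \<le> 2 * (\<rho> / R)\<^sup>2"
      using \<rho> R by (intro real_mult_power_le) (auto simp: field_simps)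
    then have "real (deg a) * \<rho> ^ deg a \<le> 2 * (\<rho> / R)\<^sup>2 * R ^ deg a"
      using R by (simp add: power_divide pos_divide_le_eq)
    then have "real (deg a) * \<rho> ^ deg a / \<rho> \<le> 2 * (\<rho> / R)\<^sup>2 * R ^ deg a / \<rho>"
      using \<rho> by (intro divide_right_mono) auto
    also have "\<dots> = R ^ deg a * (2 * \<rho> / R\<^sup>2)"
      using \<rho> by (simp add: power2_eq_square)
    finally have "\<bar>c a\<bar> * (real (deg a) * \<rho> ^ deg a / \<rho> * \<delta>) \<le> \<bar>c a\<bar> * (R ^ deg a * (2 * \<rho> / R\<^sup>2) * \<delta>)"
      using \<delta> by (intro mult_left_mono mult_right_mono) auto
    then show ?thesis using False by (simp add: M_def K_def mult_ac)
  qed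
  have M0: "0 \<le> M a" for a using \<delta> \<rho> by (simp add: M_def)
  have csum: "(\<lambda>a. \<bar>c a\<bar> * R ^ deg a) summable_on UNIV" using c by (simp add: has_ps_def)
  have KS: "(\<lambda>a. (\<bar>c a\<bar> * R ^ deg a) * K) summable_on UNIV"
    by (rule summable_on_cmult_left[OF csum])
  have M: "M summable_on UNIV"
    by (rule summable_on_comparison_test[OF KS]) (use Mle M0 in auto)
  have box: "((\<lambda>a. c a * mon (u v) a) has_sum f (u v)) UNIV"
    if u: "\<And>i. ps_bounded r \<rho> (\<lambda>v. u v $ i)" and v: "\<forall>i. \<bar>v $ i\<bar> \<le> r" for u v
  proof -
    have "\<forall>i. \<bar>u v $ i\<bar> \<le> R"
      using \<rho> by (intro allI order_trans[OF ps_bounded_abs_le[OF u v]]) simp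
    then show ?thesis using c by (simp add: has_ps_def)
  qed
  have *: "ps_bounded r (\<Sum>\<^sub>\<infinity>a. M a)
     (\<lambda>v. f (z v) - f (w v) - (\<Sum>i\<in>UNIV. c (unit_index i) * (z v $ i - w v $ i)))"
  proof (rule ps_bounded_infsum[OF _ M r])
    show "ps_bounded r (M a) (q a)" for a
    proof (cases "deg a \<le> 1")
      case True
      then show ?thesis using ps_bounded_const[of r 0] by (simp add: M_def q_def[abs_def])
    next
      case False
      then show ?thesis
        using ps_bounded_scale[OF ps_bounded_mon_diff[OF z w d r \<rho>(1)], of "c a" a]
        by (simp add: M_def q_def[abs_def])
    qed
    fix v :: "real^'b" assume v: "\<forall>i. \<bar>v $ i\<bar> \<le> r"
    let ?g = "\<lambda>a. c a * mon (z v) a - c a * mon (w v) a"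
    have 1: "(?g has_sum f (z v) - f (w v)) UNIV"
      by (intro has_sum_diff box z w v)
    have 2: "((\<lambda>a. if deg a \<le> 1 then ?g a else 0) has_sum
        (\<Sum>i\<in>UNIV. c (unit_index i) * (z v $ i - w v $ i))) UNIV"
    proof (rule has_sum_finite_neutralI[of "{a. deg a \<le> 1}"])
      show "(\<Sum>i\<in>UNIV. c (unit_index i) * (z v $ i - w v $ i)) =
          (\<Sum>a | deg a \<le> 1. if deg a \<le> 1 then ?g a else 0)"
        unfolding sum_deg_le_1 by (simp add: algebra_simps)
      show "finite {a :: 'a \<Rightarrow> nat. deg a \<le> 1}" unfolding deg_le_1 by simp
    qed auto
    have "((\<lambda>a. ?g a - (if deg a \<le> 1 then ?g a else 0)) has_sum
       f (z v) - f (w v) - (\<Sum>i\<in>UNIV. c (unit_index i) * (z v $ i - w v $ i))) UNIV"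
      by (rule has_sum_diff[OF 1 2])
    then show "((\<lambda>a. q a v) has_sum
       f (z v) - f (w v) - (\<Sum>i\<in>UNIV. c (unit_index i) * (z v $ i - w v $ i))) UNIV"
      by (rule has_sum_cong[THEN iffD1, rotated]) (auto simp: q_def algebra_simps)
  qed
  have "(\<Sum>\<^sub>\<infinity>a. M a) \<le> (\<Sum>\<^sub>\<infinity>a. (\<bar>c a\<bar> * R ^ deg a) * K)"
    by (rule infsum_mono[OF M KS]) (use Mle in auto)
  also have "\<dots> = (\<Sum>\<^sub>\<infinity>a. \<bar>c a\<bar> * R ^ deg a) * K"
    by (intro infsum_cmult_left csum)
  also have "\<dots> = 2 * \<rho> * (\<Sum>\<^sub>\<infinity>a. \<bar>c a\<bar> * R ^ deg a) / R\<^sup>2 * \<delta>"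
    by (simp add: K_def)
  finally show ?thesis by (rule ps_bounded_mono[OF *])
qed

lemma has_ps_at_0:
  assumes "has_ps R c f" "0 \<le> R"
  shows "f 0 = c (\<lambda>_. 0)"
proof -
  have "((\<lambda>a. c a * mon 0 a) has_sum f 0) UNIV"
    using assms by (simp add: has_ps_def)
  moreover have "mon (0::real^'a) a = 0" if "a \<noteq> (\<lambda>_. 0)" for a
    using that unfolding mon_def by (force simp: fun_eq_iff)
  then have "((\<lambda>a. c a * mon 0 a) has_sum c (\<lambda>_. 0)) UNIV"
    by (intro has_sum_finite_neutralI[of "{\<lambda>_. 0}"]) auto
  ultimately show ?thesis using has_sum_unique by blast
qed

text \<open>A Schwarz-type estimate: as \<open>f 0 = 0\<close> there is no constant coefficient, so
  every remaining term gains a factor \<rho>/R when the inner map has norm \<rho> instead of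
  \<open>R\<close>.\<close>

lemma ps_bounded_compose_small:
  assumes c: "has_ps R c f" and f0: "f 0 = 0" and R: "0 < R" and r: "0 < r" and \<rho>: "0 \<le> \<rho>" "\<rho> \<le> R"
    and z: "\<And>i. ps_bounded r \<rho> (\<lambda>v. z v $ i)"
  shows "ps_bounded r (\<rho> * (\<Sum>\<^sub>\<infinity>a. \<bar>c a\<bar> * R ^ deg a) / R) (\<lambda>v. f (z v))"
proof -
  have c0: "c (\<lambda>_. 0) = 0" using has_ps_at_0[OF c] f0 R by simp
  have csum: "(\<lambda>a. \<bar>c a\<bar> * R ^ deg a) summable_on UNIV" using c by (simp add: has_ps_def)
  have le: "\<bar>c a\<bar> * \<rho> ^ deg a \<le> (\<bar>c a\<bar> * R ^ deg a) * (\<rho> / R)" for a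
  proof (cases "deg a")
    case 0
    then show ?thesis using c0 by (simp add: deg_eq_0_iff)
  next
    case (Suc n)
    have "\<rho> ^ n \<le> R ^ n" using \<rho> by (intro power_mono) auto
    then have "\<bar>c a\<bar> * (\<rho> * \<rho> ^ n) \<le> \<bar>c a\<bar> * (\<rho> * R ^ n)"
      using \<rho> by (intro mult_left_mono) auto
    then show ?thesis using Suc R by (simp add: mult_ac)
  qed
  have KS: "(\<lambda>a. (\<bar>c a\<bar> * R ^ deg a) * (\<rho> / R)) summable_on UNIV"
    by (rule summable_on_cmult_left[OF csum])
  have M: "(\<lambda>a. \<bar>c a\<bar> * \<rho> ^ deg a) summable_on UNIV"
    by (rule summable_on_comparison_test[OF KS]) (use le \<rho> in auto)
  have *: "ps_bounded r (\<Sum>\<^sub>\<infinity>a. \<bar>c a\<bar> * \<rho> ^ deg a) (\<lambda>v. f (z v))"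
  proof (rule ps_bounded_infsum[OF _ M r])
    show "ps_bounded r (\<bar>c a\<bar> * \<rho> ^ deg a) (\<lambda>v. c a * mon (z v) a)" for a
      by (intro ps_bounded_scale ps_bounded_mon z r)
    show "((\<lambda>a. c a * mon (z v) a) has_sum f (z v)) UNIV" if "\<forall>i. \<bar>v $ i\<bar> \<le> r" for v
    proof -
      have "\<forall>i. \<bar>z v $ i\<bar> \<le> R"
        using \<rho> by (intro allI order_trans[OF ps_bounded_abs_le[OF z that]]) simp
      then show ?thesis using c by (simp add: has_ps_def)
    qed
  qed
  have "(\<Sum>\<^sub>\<infinity>a. \<bar>c a\<bar> * \<rho> ^ deg a) \<le> (\<Sum>\<^sub>\<infinity>a. (\<bar>c a\<bar> * R ^ deg a) * (\<rho> / R))"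
    by (rule infsum_mono[OF M KS]) (use le in auto)
  also have "\<dots> = (\<Sum>\<^sub>\<infinity>a. \<bar>c a\<bar> * R ^ deg a) * (\<rho> / R)"
    by (intro infsum_cmult_left csum)
  also have "\<dots> = \<rho> * (\<Sum>\<^sub>\<infinity>a. \<bar>c a\<bar> * R ^ deg a) / R"
    by simp
  finally show ?thesis by (rule ps_bounded_mono[OF *])
qed

text \<open>The Lipschitz estimate for the remainder is applied to the constant inner maps
  \<open>h\<close> and 0, with both \<rho> and \<delta> equal to \<open>norm h\<close>. The case
  \<open>h = 0\<close> is separate because \<rho> has to be positive there.\<close>

lemma has_ps_quadratic_remainder:
  assumes c: "has_ps R c f" and R: "0 < R" and h: "2 * norm h \<le> R"
  shows "\<bar>f h - f 0 - (\<Sum>i\<in>UNIV. c (unit_index i) * h $ i)\<bar>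
     \<le> 2 * (\<Sum>\<^sub>\<infinity>a. \<bar>c a\<bar> * R ^ deg a) / R\<^sup>2 * (norm h)\<^sup>2"
proof (cases "h = 0")
  case False
  have "ps_bounded 1 (2 * norm h * (\<Sum>\<^sub>\<infinity>a. \<bar>c a\<bar> * R ^ deg a) / R\<^sup>2 * norm h)
     (\<lambda>v::real^'a. f h - f 0 - (\<Sum>i\<in>UNIV. c (unit_index i) * (h $ i - 0 $ i)))"
    by (rule ps_bounded_diff_linear[OF c R])
      (use False h in \<open>auto intro: ps_bounded_mono[OF ps_bounded_const] component_le_norm_cart\<close>)
  from ps_bounded_abs_le[OF this, of 0] show ?thesis
    by (simp add: power2_eq_square mult_ac)
qed simp

section \<open>Analytic functions and the analytic implicit function theorem\<close>

text \<open>Here \<open>s v\<close> is the height in direction \<open>e\<close> at which the line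
  through \<open>v\<close> meets the zero set of \<open>f\<close>. The fixed-slope Newton iteration
  converges in the power series norm; continuity of \<open>s\<close> at 0 puts its values in the
  range where the fixed point is unique, so the limit is \<open>s\<close>.\<close>

lemma analytic_implicit_function:
  fixes f s :: "real^'n \<Rightarrow> real" and e :: "real^'n"
  assumes c: "has_ps R c f" and R: "0 < R" and f0: "f 0 = 0"
    and e: "norm e = 1" and D: "(\<Sum>i\<in>UNIV. c (unit_index i) * e $ i) \<noteq> 0"
    and s: "isCont s 0" "s 0 = 0"
    and fs: "\<forall>\<^sub>F v in nhds 0. f (v + (s v - v \<bullet> e) *\<^sub>R e) = 0"
  shows "\<exists>r>0. \<exists>M. ps_bounded r M s"
proof -
  define S where "S = (\<Sum>\<^sub>\<infinity>a. \<bar>c a\<bar> * R ^ deg a)"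
  define d where "d = (\<Sum>i\<in>UNIV. c (unit_index i) * e $ i)"
  define n where "n = real CARD('n)"
  have d0: "\<bar>d\<bar> > 0" using D by (simp add: d_def)
  have S0: "0 \<le> S" unfolding S_def by (rule infsum_nonneg) (use R in simp)
  have n0: "0 < n" by (simp add: n_def)
  \<comment> \<open>The first bound admits the remainder estimate; the second makes its Lipschitz
    constant at most half of \<open>\<bar>d\<bar>\<close>, so that division by \<open>d\<close>
    leaves a contraction factor 1/2. Using \<open>S + 1\<close> covers \<open>S = 0\<close>.\<close>
  define \<rho> where "\<rho> = min (R / 2) (\<bar>d\<bar> * R\<^sup>2 / (4 * (S + 1)))"
  have \<rho>: "0 < \<rho>" "2 * \<rho> \<le> R" using R d0 S0 by (auto simp: \<rho>_def)
  have contr: "2 * \<rho> * S / R\<^sup>2 \<le> \<bar>d\<bar> / 2"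
  proof -
    have "\<rho> * (4 * (S + 1)) \<le> \<bar>d\<bar> * R\<^sup>2"
      using S0 by (simp add: \<rho>_def min_le_iff_disj pos_le_divide_eq[symmetric])
    then have "4 * (\<rho> * S) \<le> \<bar>d\<bar> * R\<^sup>2" using \<rho> by (simp add: algebra_simps)
    then show ?thesis using R by (simp add: field_simps)
  qed
  define \<sigma> where "\<sigma> = \<rho> / 2"
  have \<sigma>: "0 < \<sigma>" using \<rho> by (simp add: \<sigma>_def)
  have "\<forall>\<^sub>F v in nhds 0. \<bar>s v\<bar> < \<sigma>"
  proof -
    have "(s \<longlongrightarrow> 0) (nhds 0)" using s by (metis continuous_at tendsto_nhds_iff)
    then show ?thesis using \<sigma> by (auto dest: order_tendstoD tendstoD simp: dist_real_def)
  qed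
  with fs have "\<forall>\<^sub>F v in nhds 0. f (v + (s v - v \<bullet> e) *\<^sub>R e) = 0 \<and> \<bar>s v\<bar> < \<sigma>"
    by (rule eventually_conj)
  then obtain \<eta> where \<eta>: "0 < \<eta>" and near: "\<And>v. norm v < \<eta> \<Longrightarrow> f (v + (s v - v \<bullet> e) *\<^sub>R e) = 0 \<and> \<bar>s v\<bar> < \<sigma>"
    unfolding eventually_nhds_metric by (auto simp: dist_norm)
  \<comment> \<open>The inner argument \<open>Z t\<close> has coordinates of norm at most
    \<open>(n + 1) * r\<close> plus the norm of \<open>t\<close>: one \<open>r\<close> from the
    coordinate, \<open>n * r\<close> from \<open>v \<bullet> e\<close>. The three bounds
    respectively keep this sum below \<rho> when \<open>t\<close> has norm \<sigma> = \<rho>/2, make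
    the first iterate at most \<sigma>/2, and put the box inside the ball of radius \<eta>.\<close>
  define r where "r = Min {\<sigma> / (n + 1), R * \<bar>d\<bar> * \<sigma> / (2 * (n + 1) * (S + 1)), \<eta> / (2 * n)}"
  have r: "0 < r" using \<sigma> n0 R d0 S0 \<eta> by (simp add: r_def)
  have rle: "r \<le> \<sigma> / (n + 1)" "r \<le> R * \<bar>d\<bar> * \<sigma> / (2 * (n + 1) * (S + 1))" "r \<le> \<eta> / (2 * n)"
    unfolding r_def by (rule Min_le; simp)+
  have r1: "(n + 1) * r \<le> \<sigma>" using rle(1) n0 by (simp add: field_simps)
  have r2: "(n + 1) * r * S / R / \<bar>d\<bar> \<le> \<sigma> / 2"
  proof -
    have "r * (2 * (n + 1) * (S + 1)) \<le> R * \<bar>d\<bar> * \<sigma>"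
      using rle(2) n0 S0 by (simp add: pos_le_divide_eq)
    moreover have "r * (2 * (n + 1) * S) \<le> r * (2 * (n + 1) * (S + 1))"
      using r n0 S0 by (intro mult_left_mono) auto
    ultimately have "2 * ((n + 1) * r * S) \<le> R * \<bar>d\<bar> * \<sigma>" by (simp add: mult_ac)
    then show ?thesis using R d0 by (simp add: field_simps)
  qed
  have box: "norm v < \<eta>" if "\<forall>i. \<bar>v $ i\<bar> \<le> r" for v :: "real^'n"
  proof -
    have "norm v \<le> (\<Sum>i\<in>UNIV. \<bar>v $ i\<bar>)" by (rule norm_le_l1_cart)
    also have "\<dots> \<le> (\<Sum>i\<in>(UNIV::'n set). r)" by (intro sum_mono) (use that in auto)
    also have "\<dots> = n * r" by (simp add: n_def)
    also have "\<dots> \<le> \<eta> / 2" using rle(3) n0 by (simp add: field_simps)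
    finally show ?thesis using \<eta> by simp
  qed
  \<comment> \<open>\<open>Z t v\<close> is \<open>v\<close> moved along \<open>e\<close> to height
    \<open>t v\<close>, and \<open>T\<close> is a Newton step with the slope \<open>d\<close> frozen
    at the origin. Where \<open>f (Z s v) = 0\<close>, the value \<open>s v\<close> is fixed by
    \<open>T\<close>.\<close>
  define Z where "Z t v = v + (t v - v \<bullet> e) *\<^sub>R e" for t and v :: "real^'n"
  define T where "T t v = t v - f (Z t v) / d" for t v
  have ei: "\<bar>e $ i\<bar> \<le> 1" for i using component_le_norm_cart[of e i] e by simp
  have inner_ps: "ps_bounded r (n * r) (\<lambda>v. v \<bullet> e)"
  proof -
    have "ps_bounded r (\<Sum>i\<in>(UNIV::'n set). r) (\<lambda>v. \<Sum>i\<in>UNIV. e $ i * v $ i)"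
    proof (rule ps_bounded_sum)
      fix i :: 'n
      show "ps_bounded r r (\<lambda>v. e $ i * v $ i)"
        using ps_bounded_scale[OF ps_bounded_coord[of r i], of "e $ i"] r ei[of i]
        by (rule_tac ps_bounded_mono) (auto simp: mult_left_le_one_le)
    qed (use r in auto)
    then show ?thesis by (simp add: inner_vec_def n_def mult.commute)
  qed
  have Z_ps: "ps_bounded r ((n + 1) * r + \<tau>) (\<lambda>v. Z t v $ i)" if "ps_bounded r \<tau> t" for t \<tau> i
  proof -
    have "ps_bounded r (r + \<bar>e $ i\<bar> * (\<tau> + n * r)) (\<lambda>v. v $ i + e $ i * (t v - v \<bullet> e))"
      by (intro ps_bounded_add ps_bounded_scale ps_bounded_diff ps_bounded_coord inner_ps that)
        (use r in auto)
    moreover have "\<bar>e $ i\<bar> * (\<tau> + n * r) \<le> 1 * (\<tau> + n * r)"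
      using ei[of i] ps_bounded_nonneg[OF that] r n0 by (intro mult_right_mono) auto
    ultimately have "ps_bounded r (r + \<bar>e $ i\<bar> * (\<tau> + n * r)) (\<lambda>v. Z t v $ i)"
        "r + \<bar>e $ i\<bar> * (\<tau> + n * r) \<le> (n + 1) * r + \<tau>"
      by (auto simp: Z_def algebra_simps)
    then show ?thesis by (rule ps_bounded_mono)
  qed
  have contraction: "ps_bounded r (\<delta> / 2) (\<lambda>v. T t v - T u v)"
    if t: "ps_bounded r \<sigma> t" and u: "ps_bounded r \<sigma> u" and \<delta>: "ps_bounded r \<delta> (\<lambda>v. t v - u v)"
    for t u \<delta>
  proof -
    have \<delta>0: "0 \<le> \<delta>" using ps_bounded_nonneg[OF \<delta>] r by simp
    have le: "(n + 1) * r + \<sigma> \<le> \<rho>" using r1 by (simp add: \<sigma>_def)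
    have "ps_bounded r (2 * \<rho> * S / R\<^sup>2 * \<delta>)
       (\<lambda>v. f (Z t v) - f (Z u v) - (\<Sum>i\<in>UNIV. c (unit_index i) * (Z t v $ i - Z u v $ i)))"
      unfolding S_def
    proof (rule ps_bounded_diff_linear[OF c R r \<rho>])
      show "ps_bounded r \<rho> (\<lambda>v. Z t v $ i)" "ps_bounded r \<rho> (\<lambda>v. Z u v $ i)" for i
        using ps_bounded_mono[OF Z_ps le] t u by auto
      show "ps_bounded r \<delta> (\<lambda>v. Z t v $ i - Z u v $ i)" for i
      proof -
        have "ps_bounded r (\<bar>e $ i\<bar> * \<delta>) (\<lambda>v. Z t v $ i - Z u v $ i)"
          using ps_bounded_scale[OF \<delta>, of "e $ i"] by (simp add: Z_def algebra_simps)
        then show ?thesis by (rule ps_bounded_mono) (use ei[of i] \<delta>0 in \<open>auto simp: mult_left_le_one_le\<close>)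
      qed
    qed
    moreover have "(\<Sum>i\<in>UNIV. c (unit_index i) * (Z t v $ i - Z u v $ i)) = d * (t v - u v)" for v
      by (simp add: Z_def d_def sum_distrib_right algebra_simps)
        (simp add: sum_subtractf sum_distrib_left sum_distrib_right algebra_simps)
    ultimately have "ps_bounded r (2 * \<rho> * S / R\<^sup>2 * \<delta>) (\<lambda>v. f (Z t v) - f (Z u v) - d * (t v - u v))"
      by simp
    from ps_bounded_scale[OF this, of "- 1 / d"]
    have *: "ps_bounded r (\<bar>- 1 / d\<bar> * (2 * \<rho> * S / R\<^sup>2 * \<delta>)) (\<lambda>v. T t v - T u v)"
      by (rule ps_bounded_cong) (use d0 in \<open>simp add: T_def field_simps\<close>)
    have "\<bar>- 1 / d\<bar> * (2 * \<rho> * S / R\<^sup>2 * \<delta>) \<le> \<bar>- 1 / d\<bar> * (\<bar>d\<bar> / 2 * \<delta>)"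
      by (intro mult_left_mono mult_right_mono contr \<delta>0) auto
    also have "\<dots> = \<delta> / 2" using d0 by simp
    finally show ?thesis by (rule ps_bounded_mono[OF *])
  qed
  define t where "t k = (T ^^ k) (\<lambda>_. 0)" for k
  have t_Suc: "t (Suc k) = T (t k)" for k by (simp add: t_def)
  have t0: "t 0 = (\<lambda>_. 0)" by (simp add: t_def)
  have T0: "ps_bounded r (\<sigma> / 2) (T (\<lambda>_. 0))"
  proof -
    have z0: "ps_bounded r ((n + 1) * r) (\<lambda>v. Z (\<lambda>_. 0) v $ i)" for i
      using Z_ps[of 0 "\<lambda>_. 0"] ps_bounded_const[of r 0] by simp
    have "ps_bounded r ((n + 1) * r * S / R) (\<lambda>v. f (Z (\<lambda>_. 0) v))"
      unfolding S_def
      by (rule ps_bounded_compose_small[OF c f0 R r _ _ z0]) (use r n0 r1 \<rho> in \<open>auto simp: \<sigma>_def\<close>)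
    from ps_bounded_scale[OF this, of "- 1 / d"]
    have "ps_bounded r (\<bar>- 1 / d\<bar> * ((n + 1) * r * S / R)) (T (\<lambda>_. 0))"
      by (rule ps_bounded_cong) (simp add: T_def)
    then show ?thesis by (rule ps_bounded_mono) (use r2 in \<open>simp add: mult_ac\<close>)
  qed
  \<comment> \<open>The increments halve from \<sigma>/2 on, so their partial sums stay below
    \<sigma> and the contraction estimate remains applicable.\<close>
  have iter: "ps_bounded r (\<sigma> * (1 - (1/2) ^ k)) (t k) \<and>
      ps_bounded r (\<sigma> / 2 * (1/2) ^ k) (\<lambda>v. t (Suc k) v - t k v)" for k
  proof (induction k)
    case 0
    then show ?case using T0 ps_bounded_const[of r 0] by (simp add: t0 t_Suc)
  next
    case (Suc k)
    have "ps_bounded r (\<sigma> * (1 - (1/2) ^ k) + \<sigma> / 2 * (1/2) ^ k) (\<lambda>v. t k v + (t (Suc k) v - t k v))"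
      by (intro ps_bounded_add r) (use Suc in auto)
    then have 1: "ps_bounded r (\<sigma> * (1 - (1/2) ^ Suc k)) (t (Suc k))"
      by (simp add: algebra_simps)
    have le: "\<sigma> * (1 - (1/2) ^ j) \<le> \<sigma>" for j
      using \<sigma> by (simp add: mult_le_cancel_left1)
    have "ps_bounded r (\<sigma> / 2 * (1/2) ^ k / 2) (\<lambda>v. T (t (Suc k)) v - T (t k) v)"
      by (rule contraction)
        (use Suc ps_bounded_mono[OF 1 le] ps_bounded_mono[OF conjunct1[OF Suc] le] in auto)
    then show ?case using 1 by (simp add: t_Suc)
  qed
  have conv: "\<bar>t k v - s v\<bar> \<le> \<sigma> * (1/2) ^ k" if v: "\<forall>i. \<bar>v $ i\<bar> \<le> r" for v k
  proof (induction k)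
    case 0
    then show ?case using near[OF box[OF v]] by (simp add: t0)
  next
    case (Suc k)
    have "\<bar>t k v\<bar> \<le> \<sigma> * (1 - (1/2) ^ k)"
      by (rule ps_bounded_abs_le[OF conjunct1[OF iter] v])
    also have "\<dots> \<le> \<sigma>" using \<sigma> by (simp add: mult_le_cancel_left1)
    finally have 1: "ps_bounded r \<sigma> (\<lambda>_. t k v)" using ps_bounded_mono[OF ps_bounded_const] by blast
    have 2: "ps_bounded r \<sigma> (\<lambda>_. s v)"
      by (rule ps_bounded_mono[OF ps_bounded_const]) (use near[OF box[OF v]] in simp)
    \<comment> \<open>No power series for \<open>s\<close> is available yet. At a fixed
      \<open>v\<close> the two numbers \<open>t k v\<close> and \<open>s v\<close> are therefore
      treated as constant functions, for which the contraction estimate holds, and the result is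
      evaluated at \<open>v\<close>.\<close>
    have "ps_bounded r (\<bar>t k v - s v\<bar> / 2) (\<lambda>w. T (\<lambda>_. t k v) w - T (\<lambda>_. s v) w)"
      by (rule contraction[OF 1 2 ps_bounded_const])
    from ps_bounded_abs_le[OF this v]
    have "\<bar>t (Suc k) v - s v\<bar> \<le> \<bar>t k v - s v\<bar> / 2"
      using near[OF box[OF v]] by (simp add: T_def Z_def t_Suc)
    then show ?case using Suc by simp
  qed
  have geo: "summable (\<lambda>k. \<sigma> / 2 * (1/2) ^ k)" by (intro summable_mult summable_geometric) simp
  \<comment> \<open>\<open>s\<close> is the telescoping sum of the increments, whose norms are
    dominated by a geometric series.\<close>
  have "ps_bounded r (\<Sum>\<^sub>\<infinity>k. \<sigma> / 2 * (1/2) ^ k) s"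
  proof (rule ps_bounded_infsum)
    show "ps_bounded r (\<sigma> / 2 * (1/2) ^ k) (\<lambda>v. t (Suc k) v - t k v)" for k
      using iter by blast
    show "(\<lambda>k. \<sigma> / 2 * (1/2) ^ k) summable_on UNIV"
      by (rule norm_summable_imp_summable_on) (use geo \<sigma> in \<open>simp add: abs_mult power_abs\<close>)
    fix v :: "real^'n" assume v: "\<forall>i. \<bar>v $ i\<bar> \<le> r"
    have "(\<lambda>k. \<sigma> * (1/2) ^ k) \<longlonglongrightarrow> \<sigma> * 0"
      by (intro tendsto_mult_left LIMSEQ_power_zero) simp
    then have *: "(\<lambda>k. \<sigma> * (1/2) ^ k) \<longlonglongrightarrow> 0" by simp
    have "(\<lambda>k. t k v - s v) \<longlonglongrightarrow> 0"
      by (rule Lim_null_comparison[OF _ *]) (use conv[OF v] in simp)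
    then have "(\<lambda>k. t k v) \<longlonglongrightarrow> s v" by (simp add: LIM_zero_iff)
    then have "(\<lambda>k. t (Suc k) v - t k v) sums (s v - t 0 v)" by (rule telescope_sums)
    moreover have "summable (\<lambda>k. norm (t (Suc k) v - t k v))"
      by (rule summable_comparison_test'[OF geo])
        (use ps_bounded_abs_le[OF conjunct2[OF iter] v] in simp)
    ultimately show "((\<lambda>k. t (Suc k) v - t k v) has_sum s v) UNIV"
      by (intro norm_summable_imp_has_sum) (simp_all add: t0)
  qed (fact r)
  then show ?thesis using r by blast
qed

lemma has_derivative_quadratic:
  fixes f :: "'b::real_normed_vector \<Rightarrow> 'c::real_normed_vector"
  assumes "bounded_linear L" "0 < \<eta>"
    and le: "\<And>h. norm h \<le> \<eta> \<Longrightarrow> norm (f (x + h) - f x - L h) \<le> K * (norm h)\<^sup>2"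
  shows "(f has_derivative L) (at x)"
  unfolding has_derivative_at
proof
  have lim: "((\<lambda>h::'b. K * norm h) \<longlongrightarrow> 0) (at 0)"
    by (intro tendsto_eq_intros | simp)+
  show "(\<lambda>h. norm (f (x + h) - f x - L h) / norm h) \<midarrow>0\<rightarrow> 0"
  proof (rule Lim_null_comparison[OF _ lim])
    have "norm (norm (f (x + h) - f x - L h) / norm h) \<le> K * norm h"
      if "h \<noteq> 0" "dist h 0 < \<eta>" for h
      using le[of h] that by (simp add: field_simps power2_eq_square)
    then show "\<forall>\<^sub>F h in at 0. norm (norm (f (x + h) - f x - L h) / norm h) \<le> K * norm h"
      unfolding eventually_at using assms(2) by blast
  qed
qed fact

lemma bounded_linear_coord_sum: "bounded_linear (\<lambda>h::real^'n. \<Sum>i\<in>UNIV. h $ i * g i)"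
  by (intro bounded_linear_sum bounded_linear_mult_const bounded_linear_vec_nth)

lemma coord_sum_axis: "(\<Sum>i\<in>UNIV. axis j (1::real) $ i * g i) = g j"
proof -
  have "axis j (1::real) $ i * g i = (if i = j then g i else 0)" for i
    by (simp add: axis_def)
  then show ?thesis by simp
qed

lemma has_ps_has_derivative:
  fixes f :: "real^'n \<Rightarrow> real"
  assumes c: "has_ps R c (\<lambda>v. f (x + v))" and R: "0 < R"
  shows "(f has_derivative (\<lambda>h. \<Sum>i\<in>UNIV. h $ i * c (unit_index i))) (at x)"
proof (rule has_derivative_quadratic[OF bounded_linear_coord_sum, of "R / 2"])
  show "norm (f (x + h) - f x - (\<Sum>i\<in>UNIV. h $ i * c (unit_index i)))
     \<le> 2 * (\<Sum>\<^sub>\<infinity>a. \<bar>c a\<bar> * R ^ deg a) / R\<^sup>2 * (norm h)\<^sup>2" if "norm h \<le> R / 2" for h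
    using has_ps_quadratic_remainder[OF c R, of h] that by (simp add: mult.commute)
qed (use R in simp)

text \<open>Unconditional summability of reals is absolute. Convergence at the corner (R, ..., R) of
  a box inside the ball therefore already bounds the weighted norm of the coefficients.\<close>

lemma real_analytic_on_has_ps:
  fixes f :: "real^'n \<Rightarrow> real"
  assumes "real_analytic_on U f" "x \<in> U"
  obtains R c where "0 < R" "has_ps R c (\<lambda>v. f (x + v))" "\<And>v. (\<forall>i. \<bar>v $ i\<bar> \<le> R) \<Longrightarrow> x + v \<in> U"
proof -
  from assms obtain r c where r: "0 < r" "ball x r \<subseteq> U"
    and c: "\<And>y. y \<in> ball x r \<Longrightarrow>
       ((\<lambda>a. (\<Prod>i\<in>UNIV. (y $ i - x $ i) ^ a i) *\<^sub>R c a) has_sum f y) UNIV"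
    unfolding real_analytic_on_def by blast
  define n where "n = real CARD('n)"
  have n: "0 < n" by (simp add: n_def)
  define R where "R = r / (2 * n)"
  have R: "0 < R" using r n by (simp add: R_def)
  have ball: "x + v \<in> ball x r" if "\<forall>i. \<bar>v $ i\<bar> \<le> R" for v
  proof -
    have "norm v \<le> (\<Sum>i\<in>UNIV. \<bar>v $ i\<bar>)" by (rule norm_le_l1_cart)
    also have "\<dots> \<le> (\<Sum>i\<in>(UNIV::'n set). R)" by (intro sum_mono) (use that in auto)
    also have "\<dots> = n * R" by (simp add: n_def)
    also have "\<dots> < r" using n r by (simp add: R_def)
    finally show ?thesis by (simp add: dist_norm)
  qed
  have ps: "((\<lambda>a. c a * mon v a) has_sum f (x + v)) UNIV" if "\<forall>i. \<bar>v $ i\<bar> \<le> R" for v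
    using c[OF ball[OF that]] by (simp add: mon_def mult.commute)
  have "(\<lambda>a. c a * mon (\<chi> i. R) a) summable_on UNIV"
    by (rule has_sum_imp_summable[OF ps]) (use R in simp)
  then have "(\<lambda>a. \<bar>c a * mon (\<chi> i. R) a\<bar>) summable_on UNIV"
    by (subst (asm) summable_on_iff_abs_summable_on_real) simp
  moreover have "mon (\<chi> i. R) a = R ^ deg a" for a :: "'n \<Rightarrow> nat"
    by (simp add: mon_def deg_def power_sum)
  ultimately have "has_ps R c (\<lambda>v. f (x + v))"
    using R ps by (simp add: has_ps_def abs_mult)
  then show ?thesis using that R ball r(2) by blast
qed

lemma real_analytic_onI:
  fixes f :: "real^'n \<Rightarrow> real"
  assumes U: "open U" and f: "\<And>x. x \<in> U \<Longrightarrow> \<exists>r>0. \<exists>M. ps_bounded r M (\<lambda>v. f (x + v))"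
  shows "real_analytic_on U f"
  unfolding real_analytic_on_def
proof
  fix x assume x: "x \<in> U"
  from f[OF x] obtain r c where r: "0 < r" and c: "has_ps r c (\<lambda>v. f (x + v))"
    unfolding ps_bounded_def by blast
  from U x obtain s where s: "0 < s" "ball x s \<subseteq> U" by (meson openE)
  have "((\<lambda>a. (\<Prod>i\<in>UNIV. (y $ i - x $ i) ^ a i) *\<^sub>R c a) has_sum f y) UNIV"
    if "y \<in> ball x (min r s)" for y
  proof -
    have "\<bar>(y - x) $ i\<bar> \<le> r" for i
      using component_le_norm_cart[of "y - x" i] that by (simp add: dist_norm norm_minus_commute)
    then have "((\<lambda>a. c a * mon (y - x) a) has_sum f (x + (y - x))) UNIV"
      using c unfolding has_ps_def by blast
    then show ?thesis by (simp add: mon_def mult.commute)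
  qed
  then show "\<exists>r>0. \<exists>c. ball x r \<subseteq> U \<and> (\<forall>y\<in>ball x r.
       ((\<lambda>a. (\<Prod>i\<in>UNIV. (y $ i - x $ i) ^ a i) *\<^sub>R c a) has_sum f y) UNIV)"
    using r s by (intro exI[of _ "min r s"] conjI exI[of _ c]) auto
qed

section \<open>Gradients of real-analytic functions\<close>

abbreviation partial :: "'n \<Rightarrow> (real^'n \<Rightarrow> real) \<Rightarrow> real^'n \<Rightarrow> real" where
  "partial j f x \<equiv> frechet_derivative f (at x) (axis j 1)"

lemma partial_eqI:
  assumes "(f has_derivative (\<lambda>h. \<Sum>i\<in>UNIV. h $ i * g i)) (at x)"
  shows "partial j f x = g j"
  using frechet_derivative_at[OF assms] coord_sum_axis by metis

lemma has_ps_partial: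
  assumes "has_ps R c (\<lambda>v. f (x + v))" and "0 < R"
  shows "partial j f x = c (unit_index j)"
  by (rule partial_eqI[OF has_ps_has_derivative[OF assms]])

lemma real_analytic_on_has_derivative:
  assumes "real_analytic_on U f" "x \<in> U"
  shows "(f has_derivative (\<lambda>h. \<Sum>i\<in>UNIV. h $ i * partial i f x)) (at x)"
proof -
  from real_analytic_on_has_ps[OF assms] obtain R c
    where R: "0 < R" "has_ps R c (\<lambda>v. f (x + v))" by metis
  have "(\<lambda>i. partial i f x) = (\<lambda>i. c (unit_index i))"
    using has_ps_partial[OF R(2,1)] by auto
  from fun_cong[OF this] show ?thesis
    using has_ps_has_derivative[OF R(2,1)] by simp
qed

text \<open>Re-expanding the power series at nearby points gives a quadratic remainder estimate that is
  uniform in the base point; this forces the gradient to be Lipschitz.\<close>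

lemma real_analytic_on_continuous_partial:
  fixes f :: "real^'n \<Rightarrow> real"
  assumes f: "real_analytic_on U f"
  shows "continuous_on U (partial j f)"
proof (intro continuous_at_imp_continuous_on ballI)
  fix x assume x: "x \<in> U"
  from real_analytic_on_has_ps[OF f x] obtain R c
    where R: "0 < R" and c: "has_ps R c (\<lambda>v. f (x + v))"
    by metis
  define S where "S = (\<Sum>\<^sub>\<infinity>a. \<bar>c a\<bar> * R ^ deg a)"
  define L where "L y h = (\<Sum>i\<in>UNIV. h $ i * partial i f y)" for y and h :: "real^'n"
  define K where "K = 2 * S / (R / 2)\<^sup>2"
  have K: "\<bar>f (y + h) - f y - L y h\<bar> \<le> K * (norm h)\<^sup>2"
    if y: "norm (y - x) \<le> R / 2" and h: "norm h \<le> R / 4" for y h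
  proof -
    \<comment> \<open>Re-expansion at \<open>y\<close>: each coordinate of the translation by
      \<open>y - x\<close> has norm at most R/2 + R/2, so composition keeps the bound
      \<open>S\<close>, independently of \<open>y\<close>.\<close>
    have "ps_bounded (R / 2) S (\<lambda>v. f (x + ((y - x) + v)))"
    proof (rule ps_bounded_compose[where R=R and f="\<lambda>w. f (x + w)" and z="\<lambda>v. (y - x) + v"])
      show "ps_bounded R S (\<lambda>v. f (x + v))" using c by (auto simp: ps_bounded_def S_def)
      fix i
      have "ps_bounded (R / 2) (\<bar>(y - x) $ i\<bar> + R / 2) (\<lambda>v. (y - x) $ i + v $ i)"
        by (intro ps_bounded_add ps_bounded_const ps_bounded_coord) (use R in auto)
      then have "ps_bounded (R / 2) R (\<lambda>v. (y - x) $ i + v $ i)"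
        by (rule ps_bounded_mono) (use component_le_norm_cart[of "y - x" i] y in simp)
      then show "ps_bounded (R / 2) R (\<lambda>v. ((y - x) + v) $ i)" by simp
    qed (use R in auto)
    then obtain c' where c': "has_ps (R / 2) c' (\<lambda>v. f (y + v))"
      and le: "(\<Sum>\<^sub>\<infinity>a. \<bar>c' a\<bar> * (R / 2) ^ deg a) \<le> S"
      by (auto simp: ps_bounded_def)
    have L: "L y h = (\<Sum>i\<in>UNIV. c' (unit_index i) * h $ i)"
      unfolding L_def using has_ps_partial[OF c'] R by (simp add: mult.commute)
    have "\<bar>f (y + h) - f y - L y h\<bar>
        \<le> 2 * (\<Sum>\<^sub>\<infinity>a. \<bar>c' a\<bar> * (R / 2) ^ deg a) / (R / 2)\<^sup>2 * (norm h)\<^sup>2"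
      using has_ps_quadratic_remainder[OF c', of h] R h unfolding L by simp
    also have "\<dots> \<le> K * (norm h)\<^sup>2" unfolding K_def
      by (intro mult_right_mono divide_right_mono mult_left_mono le) auto
    finally show ?thesis .
  qed
  have lin: "L y (u + w) = L y u + L y w" for y u w
    by (simp add: L_def algebra_simps sum.distrib)
  have "\<bar>partial j f y - partial j f x\<bar> \<le> 6 * K * norm (y - x)"
    if y: "norm (y - x) \<le> R / 8" for y
  proof (cases "y = x")
    case False
    \<comment> \<open>\<open>f (y + h)\<close> is expanded once at \<open>y\<close> and once at
      \<open>x\<close> with increment \<open>k + h\<close>; comparison leaves
      \<open>L y h - L x h\<close> up to three remainders, contributing 1 + 1 + 4 = 6 times
      \<open>K * (norm k)\<^sup>2\<close>. Choosing \<open>h\<close> along the j-th axis with the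
      length of \<open>k\<close> isolates the j-th partial derivative after one division by that
      length.\<close>
    define k h where "k = y - x" and "h = norm (y - x) *\<^sub>R (axis j 1 :: real^'n)"
    have nk: "0 < norm k" using False by (simp add: k_def)
    have nh: "norm h = norm k" by (simp add: h_def k_def)
    have nkh: "norm (k + h) \<le> 2 * norm k" using norm_triangle_ineq[of k h] nh by simp
    have Lh: "L z h = norm k * partial j f z" for z
    proof -
      have "L z h = norm k * (\<Sum>i\<in>UNIV. (axis j (1::real)) $ i * partial i f z)"
        by (simp add: L_def h_def k_def sum_distrib_left mult.assoc)
      then show ?thesis by (simp only: coord_sum_axis)
    qed
    have 1: "\<bar>f (y + h) - f y - L y h\<bar> \<le> K * (norm k)\<^sup>2"
      using K[of y h] y R nh by (simp add: k_def)
    have 2: "\<bar>f (x + k) - f x - L x k\<bar> \<le> K * (norm k)\<^sup>2"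
      using K[of x k] y R by (simp add: k_def)
    have K0: "0 \<le> K" unfolding K_def S_def
      by (intro divide_nonneg_nonneg mult_nonneg_nonneg infsum_nonneg) (use R in auto)
    have "\<bar>f (x + (k + h)) - f x - L x (k + h)\<bar> \<le> K * (norm (k + h))\<^sup>2"
      using K[of x "k + h"] y R nkh by (simp add: k_def)
    also have "\<dots> \<le> K * (2 * norm k)\<^sup>2"
      by (intro mult_left_mono power_mono nkh K0) auto
    finally have 3: "\<bar>f (y + h) - f x - (L x k + L x h)\<bar> \<le> 4 * K * (norm k)\<^sup>2"
      by (simp add: lin k_def power_mult_distrib add.assoc[symmetric])
    have "\<bar>L y h - L x h\<bar> \<le> 6 * K * (norm k)\<^sup>2"
      using 1 2 3 by (simp add: k_def)
    then have "norm k * \<bar>partial j f y - partial j f x\<bar> \<le> norm k * (6 * K * norm k)"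
      by (simp add: Lh right_diff_distrib[symmetric] abs_mult power2_eq_square mult_ac)
    then show ?thesis using nk by (simp add: k_def)
  qed simp
  note lip = this
  have lim: "((\<lambda>y. 6 * K * norm (y - x)) \<longlongrightarrow> 0) (at x)"
    by (intro tendsto_eq_intros | simp)+
  have "((\<lambda>y. partial j f y - partial j f x) \<longlongrightarrow> 0) (at x)"
  proof (rule Lim_null_comparison[OF _ lim])
    show "\<forall>\<^sub>F y in at x. norm (partial j f y - partial j f x) \<le> 6 * K * norm (y - x)"
      unfolding eventually_at using lip R
      by (intro exI[of _ "R / 8"]) (auto simp: dist_norm)
  qed
  then show "isCont (partial j f) x"
    by (simp add: isCont_def LIM_zero_iff)
qed

section \<open>Functions with iterated gradients\<close>

text \<open>A recursive form of the class C^k on open sets: the gradient is any witness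
  \<open>g\<close>, and its components lie in the previous class. Stability under algebraic
  operations thus becomes an induction on \<open>k\<close> with the function generalised, free of
  lists of directions.\<close>

primrec Ck_grad :: "nat \<Rightarrow> (real^'n) set \<Rightarrow> (real^'n \<Rightarrow> real) \<Rightarrow> bool" where
  "Ck_grad 0 U f \<longleftrightarrow> continuous_on U f"
| "Ck_grad (Suc k) U f \<longleftrightarrow>
     (\<exists>g. (\<forall>j. Ck_grad k U (\<lambda>x. g x $ j)) \<and> (\<forall>x\<in>U. GDERIV f x :> g x))"

lemma Ck_grad_imp_continuous_on: "Ck_grad k U f \<Longrightarrow> continuous_on U f"
proof (cases k)
  case (Suc n)
  assume "Ck_grad k U f"
  then obtain g where "\<And>x. x \<in> U \<Longrightarrow> GDERIV f x :> g x" using Suc by auto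
  then show ?thesis
    by (intro continuous_at_imp_continuous_on ballI) (meson gderiv_def has_derivative_continuous)
qed simp

lemma Ck_grad_SucD: "Ck_grad (Suc k) U f \<Longrightarrow> Ck_grad k U f"
proof (induction k arbitrary: f)
  case 0
  then show ?case using Ck_grad_imp_continuous_on[of "Suc 0" U f] by simp
next
  case (Suc k)
  from Suc.prems obtain g where "\<forall>j. Ck_grad (Suc k) U (\<lambda>x. g x $ j)" "\<forall>x\<in>U. GDERIV f x :> g x"
    unfolding Ck_grad.simps(2)[of "Suc k"] by blast
  then show ?case using Suc.IH unfolding Ck_grad.simps(2)[of k] by blast
qed

lemma Ck_grad_mono:
  assumes "Ck_grad k U f" "j \<le> k"
  shows "Ck_grad j U f"
  using assms(2,1) by (induction rule: inc_induct) (auto intro: Ck_grad_SucD simp del: Ck_grad.simps)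

lemma Ck_grad_subset:
  assumes "Ck_grad k U f" "V \<subseteq> U"
  shows "Ck_grad k V f"
  using assms
  by (induction k arbitrary: f) (auto intro: continuous_on_subset, blast)

lemma GDERIV_cong_open:
  fixes f g :: "'a::real_inner \<Rightarrow> real"
  assumes "GDERIV f x :> d" "open U" "x \<in> U" "\<And>y. y \<in> U \<Longrightarrow> f y = g y"
  shows "GDERIV g x :> d"
  using assms has_derivative_transform_within_open unfolding gderiv_def by blast

lemma GDERIV_unique:
  fixes f :: "'a::real_inner \<Rightarrow> real"
  assumes "GDERIV f x :> d" "GDERIV f x :> d'"
  shows "d = d'"
proof -
  have "(\<lambda>h. h \<bullet> d) = (\<lambda>h. h \<bullet> d')"
    using assms has_derivative_unique unfolding gderiv_def by blast
  then have "(d - d') \<bullet> (d - d') = 0" by (metis inner_diff_right right_minus_eq)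
  then show ?thesis by simp
qed

lemma Ck_grad_cong:
  assumes "Ck_grad k U f" "open U" "\<And>x. x \<in> U \<Longrightarrow> f x = g x"
  shows "Ck_grad k U g"
proof (cases k)
  case 0
  then show ?thesis using assms by (simp cong: continuous_on_cong)
next
  case (Suc n)
  then obtain d where d: "\<forall>j. Ck_grad n U (\<lambda>x. d x $ j)" "\<And>x. x \<in> U \<Longrightarrow> GDERIV f x :> d x"
    using assms by auto
  have "GDERIV g x :> d x" if "x \<in> U" for x
    by (rule GDERIV_cong_open[OF d(2)[OF that] assms(2) that]) (rule assms(3))
  then show ?thesis using Suc d by auto
qed

lemma Ck_grad_const: "Ck_grad k U (\<lambda>_. c)"
proof (induction k arbitrary: c)
  case (Suc k)
  then show ?case by (auto intro!: exI[of _ "\<lambda>_. 0"] GDERIV_const)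
qed simp

lemma Ck_grad_add:
  assumes "Ck_grad k U f" "Ck_grad k U g"
  shows "Ck_grad k U (\<lambda>x. f x + g x)"
  using assms
proof (induction k arbitrary: f g)
  case (Suc k)
  then obtain df dg where
    "\<forall>j. Ck_grad k U (\<lambda>x. df x $ j)" "\<forall>x\<in>U. GDERIV f x :> df x"
    "\<forall>j. Ck_grad k U (\<lambda>x. dg x $ j)" "\<forall>x\<in>U. GDERIV g x :> dg x"
    by auto
  then show ?case using Suc.IH
    by (auto intro!: exI[of _ "\<lambda>x. df x + dg x"] GDERIV_add)
qed (auto intro: continuous_intros)

lemma Ck_grad_mult:
  assumes "Ck_grad k U f" "Ck_grad k U g"
  shows "Ck_grad k U (\<lambda>x. f x * g x)"
  using assms
proof (induction k arbitrary: f g)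
  case (Suc k)
  then obtain df dg where d:
    "\<forall>j. Ck_grad k U (\<lambda>x. df x $ j)" "\<forall>x\<in>U. GDERIV f x :> df x"
    "\<forall>j. Ck_grad k U (\<lambda>x. dg x $ j)" "\<forall>x\<in>U. GDERIV g x :> dg x"
    by auto
  have "Ck_grad k U (\<lambda>x. f x * dg x $ j + g x * df x $ j)" for j
    using d Ck_grad_SucD[OF Suc.prems(1)] Ck_grad_SucD[OF Suc.prems(2)]
    by (intro Ck_grad_add Suc.IH) auto
  then show ?case using d
    by (auto intro!: exI[of _ "\<lambda>x. f x *\<^sub>R dg x + g x *\<^sub>R df x"] GDERIV_mult)
qed (auto intro: continuous_intros)

lemma Ck_grad_diff:
  assumes "Ck_grad k U f" "Ck_grad k U g"
  shows "Ck_grad k U (\<lambda>x. f x - g x)"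
  using Ck_grad_add[OF assms(1) Ck_grad_mult[OF Ck_grad_const[of k U "-1"] assms(2)]] by simp

lemma Ck_grad_sum:
  assumes "\<And>i. i \<in> I \<Longrightarrow> Ck_grad k U (f i)"
  shows "Ck_grad k U (\<lambda>x. \<Sum>i\<in>I. f i x)"
  using assms
  by (induction I rule: infinite_finite_induct) (auto intro: Ck_grad_const Ck_grad_add)

text \<open>The gradient of the inverse contains the inverse itself, but only in the class one order
  lower, which the induction hypothesis supplies.\<close>

lemma Ck_grad_inverse:
  assumes "Ck_grad k U f" "\<And>x. x \<in> U \<Longrightarrow> f x \<noteq> 0"
  shows "Ck_grad k U (\<lambda>x. inverse (f x))"
  using assms
proof (induction k arbitrary: f)
  case (Suc k)
  then obtain df where d: "\<forall>j. Ck_grad k U (\<lambda>x. df x $ j)" "\<forall>x\<in>U. GDERIV f x :> df x"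
    by auto
  have "Ck_grad k U (\<lambda>x. inverse (f x))"
    by (rule Suc.IH[OF Ck_grad_SucD[OF Suc.prems(1)] Suc.prems(2)])
  then have "Ck_grad k U (\<lambda>x. (-1) * (inverse (f x) * inverse (f x)) * df x $ j)" for j
    using d by (intro Ck_grad_mult Ck_grad_const) auto
  moreover have "\<forall>x\<in>U. GDERIV (\<lambda>x. inverse (f x)) x :> - (inverse (f x))\<^sup>2 *\<^sub>R df x"
    using d(2) Suc.prems(2) by (intro ballI GDERIV_inverse) blast+
  ultimately show ?case
    by (auto intro!: exI[of _ "\<lambda>x. - (inverse (f x))\<^sup>2 *\<^sub>R df x"] simp: power2_eq_square)
qed (auto intro: continuous_intros)

section \<open>Passage between iterated gradients, iterated partial derivatives and Hoelder
  classes\<close>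

lemma GDERIV_frechet_derivative:
  assumes "GDERIV f x :> d"
  shows "frechet_derivative f (at x) (axis j 1) = d $ j"
  using frechet_derivative_at[OF assms[unfolded gderiv_def]] by (metis inner_axis' inner_real_def mult_1)

lemma Ck_grad_iter_partial:
  assumes "open U" "Ck_grad (k + length ks) U f"
  shows "Ck_grad k U (iter_partial ks f)"
  using assms(2)
proof (induction ks arbitrary: k)
  case (Cons j ks)
  then have "Ck_grad (Suc k) U (iter_partial ks f)" by (simp del: Ck_grad.simps)
  then obtain g where g: "\<forall>j. Ck_grad k U (\<lambda>x. g x $ j)" "\<forall>x\<in>U. GDERIV (iter_partial ks f) x :> g x"
    by auto
  show ?case
    by (rule Ck_grad_cong[OF spec[OF g(1), of j] assms(1)])
      (simp add: GDERIV_frechet_derivative[OF bspec[OF g(2)]])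
qed simp

lemma Ck_grad_imp_Ck_on:
  assumes "open U" "Ck_grad k U f"
  shows "Ck_on k U f"
  unfolding Ck_on_def
proof (intro conjI allI impI ballI)
  fix ks :: "'a list" and x assume ks: "length ks < k" and x: "x \<in> U"
  have "Ck_grad (Suc 0) U (iter_partial ks f)"
    by (rule Ck_grad_iter_partial[OF assms(1)], rule Ck_grad_mono[OF assms(2)]) (use ks in simp)
  then show "iter_partial ks f differentiable at x"
    using x by (auto simp: gderiv_def differentiable_def)
next
  fix ks :: "'a list" assume ks: "length ks \<le> k"
  have "Ck_grad 0 U (iter_partial ks f)"
    by (rule Ck_grad_iter_partial[OF assms(1)], rule Ck_grad_mono[OF assms(2)]) (use ks in simp)
  then show "continuous_on U (iter_partial ks f)" by simp
qed

lemma differentiable_imp_GDERIV: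
  fixes f :: "real^'n \<Rightarrow> real"
  assumes "f differentiable (at x)"
  shows "GDERIV f x :> (\<chi> j. frechet_derivative f (at x) (axis j 1))"
proof -
  let ?D = "frechet_derivative f (at x)"
  have D: "(f has_derivative ?D) (at x)" using assms frechet_derivative_works by blast
  have eq: "?D h = h \<bullet> (\<chi> j. ?D (axis j 1))" for h
  proof -
    have "?D h = ?D (\<Sum>j\<in>UNIV. h $ j *\<^sub>R axis j 1)"
      using basis_expansion[of h] by (simp add: scalar_mult_eq_scaleR)
    also have "\<dots> = (\<Sum>j\<in>UNIV. h $ j * ?D (axis j 1))"
      using has_derivative_linear[OF D] by (simp add: linear_sum linear_cmul)
    finally show ?thesis by (simp add: inner_vec_def)
  qed
  show ?thesis unfolding gderiv_def
    by (rule has_derivative_eq_rhs[OF D]) (rule ext, rule eq)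
qed

lemma differentiable_imp_GDERIV_nth:
  fixes f :: "real^'n \<Rightarrow> real^'m"
  assumes "f differentiable (at x)"
  shows "GDERIV (\<lambda>y. f y $ i) x :> (\<chi> j. frechet_derivative f (at x) (axis j 1) $ i)"
proof -
  let ?D = "frechet_derivative f (at x)"
  have "(f has_derivative ?D) (at x)" using assms frechet_derivative_works by blast
  then have D: "((\<lambda>y. f y $ i) has_derivative (\<lambda>h. ?D h $ i)) (at x)"
    by (rule bounded_linear.has_derivative[OF bounded_linear_vec_nth])
  then have "(\<lambda>y. f y $ i) differentiable (at x)" by (rule differentiableI)
  from differentiable_imp_GDERIV[OF this] show ?thesis
    by (simp add: frechet_derivative_at[OF D, symmetric])
qed

lemma Ck_on_1_imp_Ck_grad:
  fixes f :: "real^'n \<Rightarrow> real"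
  assumes "Ck_on 1 U f"
  shows "Ck_grad 1 U f"
proof -
  have d: "f differentiable (at x)" if "x \<in> U" for x
    using assms that unfolding Ck_on_def by (metis iter_partial.simps(1) length_0_conv less_one)
  have "continuous_on U (iter_partial [j] f)" for j
    using assms unfolding Ck_on_def by (metis One_nat_def length_Cons list.size(3) order_refl)
  then have "continuous_on U (\<lambda>x. (\<chi> j. frechet_derivative f (at x) (axis j 1)) $ j)" for j
    by simp
  then show ?thesis using differentiable_imp_GDERIV[OF d]
    unfolding One_nat_def Ck_grad.simps
    by (intro exI[of _ "\<lambda>x. \<chi> j. frechet_derivative f (at x) (axis j 1)"] conjI allI ballI)
qed

text \<open>On the compact closed ball the gradients of the order-k partials are bounded, so these
  partials are Lipschitz on the convex open ball. On a set of diameter at most 2r, Lipschitz implies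
  Hoelder.\<close>

lemma Ck_grad_imp_Ck_holder_on_ball:
  assumes "open V" "Ck_grad (Suc k) V f" "cball x r \<subseteq> V" "0 < \<alpha>" "\<alpha> \<le> 1"
  shows "Ck_holder_on k \<alpha> (ball x r) f"
  unfolding Ck_holder_on_def
proof (intro conjI allI impI)
  have sub: "ball x r \<subseteq> V" using assms(3) ball_subset_cball by blast
  show "Ck_on k (ball x r) f"
    by (rule Ck_grad_imp_Ck_on[OF open_ball Ck_grad_SucD[OF Ck_grad_subset[OF assms(2) sub]]])
  fix ks :: "'a list" assume ks: "length ks = k"
  let ?u = "iter_partial ks f"
  have "Ck_grad (Suc 0) V ?u"
    by (rule Ck_grad_iter_partial[OF assms(1)]) (use ks assms in simp)
  then obtain g where g: "\<forall>j. continuous_on V (\<lambda>x. g x $ j)" "\<forall>x\<in>V. GDERIV ?u x :> g x"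
    by auto
  have "continuous_on V (\<lambda>x. \<chi> j. g x $ j)" using g(1) by (intro continuous_on_vec_lambda) auto
  then have "continuous_on (cball x r) g" using assms(3) continuous_on_subset by simp
  then have "bounded (g ` cball x r)"
    by (intro compact_imp_bounded compact_continuous_image) auto
  then obtain B where B: "0 < B" "\<And>y. y \<in> cball x r \<Longrightarrow> norm (g y) \<le> B"
    unfolding bounded_pos by auto
  have lip: "norm (?u y - ?u z) \<le> B * norm (y - z)" if "y \<in> ball x r" "z \<in> ball x r" for y z
  proof (rule differentiable_bound[OF convex_ball _ _ that])
    fix w assume w: "w \<in> ball x r"
    then show "(?u has_derivative (\<lambda>h. h \<bullet> g w)) (at w within ball x r)"
      using g(2) sub unfolding gderiv_def by (meson has_derivative_at_withinI subsetD)
    show "onorm (\<lambda>h. h \<bullet> g w) \<le> B"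
    proof (rule onorm_bound)
      fix h
      have "norm (h \<bullet> g w) \<le> norm h * norm (g w)" using Cauchy_Schwarz_ineq2 by simp
      also have "\<dots> \<le> norm h * B" using B w by (intro mult_left_mono) auto
      finally show "norm (h \<bullet> g w) \<le> B * norm h" by (simp add: mult.commute)
    qed (use B in simp)
  qed
  \<comment> \<open>One splits dist = dist^(1-\<alpha>) dist^\<alpha> and bounds the first factor
    through the diameter.\<close>
  have "dist (?u y) (?u z) \<le> (B * (2 * r) powr (1 - \<alpha>)) * dist y z powr \<alpha>"
    if "y \<in> ball x r" "z \<in> ball x r" for y z
  proof -
    have "dist y z \<le> 2 * r" using that dist_triangle2[of y z x] by (simp add: dist_commute)
    then have "dist y z powr (1 - \<alpha>) \<le> (2 * r) powr (1 - \<alpha>)"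
      using assms by (intro powr_mono2) auto
    then have "dist y z powr (1 - \<alpha>) * dist y z powr \<alpha> \<le> (2 * r) powr (1 - \<alpha>) * dist y z powr \<alpha>"
      by (intro mult_right_mono) auto
    moreover have "dist y z powr (1 - \<alpha>) * dist y z powr \<alpha> = dist y z"
      by (simp add: powr_add[symmetric])
    ultimately have "B * dist y z \<le> B * ((2 * r) powr (1 - \<alpha>) * dist y z powr \<alpha>)"
      using B by (intro mult_left_mono) auto
    then show ?thesis using lip[OF that] by (simp add: dist_norm mult.assoc)
  qed
  then show "holder_on \<alpha> (ball x r) ?u" unfolding holder_on_def by blast
qed

text \<open>The recursive counterpart of \<open>Ck_closure\<close>. \<open>G\<close> is the gradient
  only inside \<Omega>; on the boundary it is the continuous extension, and nothing is
  differentiated there.\<close>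

primrec Ck_grad_closure :: "nat \<Rightarrow> (real^'n) set \<Rightarrow> (real^'n \<Rightarrow> real) \<Rightarrow> bool" where
  "Ck_grad_closure 0 \<Omega> H \<longleftrightarrow> continuous_on (closure \<Omega>) H"
| "Ck_grad_closure (Suc k) \<Omega> H \<longleftrightarrow> continuous_on (closure \<Omega>) H \<and>
     (\<exists>G. (\<forall>j. Ck_grad_closure k \<Omega> (\<lambda>x. G x $ j)) \<and> (\<forall>x\<in>\<Omega>. GDERIV H x :> G x))"

lemma Ck_grad_closure_imp_continuous_on:
  "Ck_grad_closure k \<Omega> H \<Longrightarrow> continuous_on (closure \<Omega>) H"
  by (cases k) auto

lemma Ck_grad_closure_SucD: "Ck_grad_closure (Suc k) \<Omega> H \<Longrightarrow> Ck_grad_closure k \<Omega> H"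
proof (induction k arbitrary: H)
  case (Suc k)
  from Suc.prems obtain G where "continuous_on (closure \<Omega>) H"
    "\<forall>j. Ck_grad_closure (Suc k) \<Omega> (\<lambda>x. G x $ j)" "\<forall>x\<in>\<Omega>. GDERIV H x :> G x"
    unfolding Ck_grad_closure.simps(2)[of "Suc k"] by blast
  then show ?case using Suc.IH unfolding Ck_grad_closure.simps(2)[of k] by blast
qed simp

lemma Ck_grad_closure_diff_const:
  assumes "Ck_grad_closure k \<Omega> H"
  shows "Ck_grad_closure k \<Omega> (\<lambda>x. H x - c)"
proof (cases k)
  case 0
  then show ?thesis using assms by (auto intro: continuous_intros)
next
  case (Suc n)
  then obtain G where G: "continuous_on (closure \<Omega>) H"
    "\<forall>j. Ck_grad_closure n \<Omega> (\<lambda>x. G x $ j)" "\<forall>x\<in>\<Omega>. GDERIV H x :> G x"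
    using assms by auto
  have "\<forall>x\<in>\<Omega>. GDERIV (\<lambda>x. H x - c) x :> G x"
    using GDERIV_diff[OF bspec[OF G(3)] GDERIV_const[of c]] by simp
  moreover have "continuous_on (closure \<Omega>) (\<lambda>x. H x - c)"
    by (intro continuous_intros G)
  ultimately show ?thesis using Suc G(2) by auto
qed

text \<open>The chosen extensions \<open>g ks\<close> are already linked: inside \<Omega>, the
  gradient of \<open>g ks\<close> consists of the \<open>g (j # ks)\<close>. So they serve as the
  witnesses at every level of the recursion.\<close>

lemma Ck_grad_closure_of_partials:
  fixes \<Psi> :: "real^'n \<Rightarrow> real^'m"
  assumes "open \<Omega>" and \<Psi>: "Ck_on N \<Omega> \<Psi>"
    and g: "\<And>ks. length ks \<le> N \<Longrightarrow> continuous_on (closure \<Omega>) (g ks)"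
    and eq: "\<And>ks x. length ks \<le> N \<Longrightarrow> x \<in> \<Omega> \<Longrightarrow> g ks x = iter_partial ks \<Psi> x"
    and "length ks + k \<le> N"
  shows "Ck_grad_closure k \<Omega> (\<lambda>x. g ks x $ i)"
  using assms(5)
proof (induction k arbitrary: ks)
  case 0
  then show ?case using g[of ks] by (simp add: continuous_on_component)
next
  case (Suc k)
  define G where "G x = (\<chi> j. g (j # ks) x $ i)" for x
  have "Ck_grad_closure k \<Omega> (\<lambda>x. G x $ j)" for j
    using Suc.IH[of "j # ks"] Suc.prems by (simp add: G_def)
  moreover have "GDERIV (\<lambda>x. g ks x $ i) x :> G x" if x: "x \<in> \<Omega>" for x
  proof -
    have "iter_partial ks \<Psi> differentiable (at x)"
      using \<Psi> x Suc.prems unfolding Ck_on_def by simp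
    from differentiable_imp_GDERIV_nth[OF this]
    have d: "GDERIV (\<lambda>y. iter_partial ks \<Psi> y $ i) x :> G x"
      using eq[of "_ # ks", OF _ x] Suc.prems by (simp add: G_def)
    show ?thesis
      by (rule GDERIV_cong_open[OF d \<open>open \<Omega>\<close> x]) (use eq[of ks] Suc.prems in simp)
  qed
  moreover have "continuous_on (closure \<Omega>) (\<lambda>x. g ks x $ i)"
    using g[of ks] Suc.prems by (simp add: continuous_on_component)
  ultimately show ?case by auto
qed

text \<open>\<open>H\<close> need not be differentiable at the boundary point \<open>p x\<close> itself: the derivative is the uniform limit of
  those of \<open>y \<mapsto> H (p y - \<epsilon> e)\<close>, for which the chain rule applies inside \<open>\<Omega>\<close>.\<close>

lemma has_derivative_closure_comp:
  fixes H :: "real^'n \<Rightarrow> real" and p :: "'b::real_normed_vector \<Rightarrow> real^'n"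
  assumes "bounded \<Omega>" and H: "continuous_on (closure \<Omega>) H" and G: "continuous_on (closure \<Omega>) G"
    and dH: "\<And>x. x \<in> \<Omega> \<Longrightarrow> GDERIV H x :> G x"
    and r: "0 < r" and dp: "\<And>y. y \<in> ball x r \<Longrightarrow> (p has_derivative p' y) (at y)"
    and p'_le: "\<And>y h. y \<in> ball x r \<Longrightarrow> norm (p' y h) \<le> K * norm h"
    and \<delta>: "0 < \<delta>" and inside: "\<And>y \<epsilon>. y \<in> ball x r \<Longrightarrow> 0 < \<epsilon> \<Longrightarrow> \<epsilon> \<le> \<delta> \<Longrightarrow> p y - \<epsilon> *\<^sub>R e \<in> \<Omega>"
  shows "((\<lambda>y. H (p y)) has_derivative (\<lambda>h. p' x h \<bullet> G (p x))) (at x)"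
proof -
  define \<epsilon> where "\<epsilon> n = \<delta> / (real n + 1)" for n
  have \<epsilon>: "0 < \<epsilon> n" "\<epsilon> n \<le> \<delta>" for n using \<delta> by (auto simp: \<epsilon>_def field_simps)
  have \<epsilon>_lim: "\<epsilon> \<longlonglongrightarrow> 0"
    unfolding \<epsilon>_def using tendsto_mult_right_zero[OF LIMSEQ_inverse_real_of_nat, of \<delta>]
    by (simp add: field_simps)
  have shift_lim: "(\<lambda>n. p y - \<epsilon> n *\<^sub>R e) \<longlonglongrightarrow> p y" for y
    by (rule tendsto_eq_intros \<epsilon>_lim | simp)+
  have in_\<Omega>: "p y - \<epsilon> n *\<^sub>R e \<in> \<Omega>" if "y \<in> ball x r" for y n
    using inside[OF that \<epsilon>] .
  have in_cl: "p y \<in> closure \<Omega>" if "y \<in> ball x r" for y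
    unfolding closure_sequential using in_\<Omega>[OF that] shift_lim
    by (intro exI[of _ "\<lambda>n. p y - \<epsilon> n *\<^sub>R e"]) auto
  have lim: "(\<lambda>n. H (p y - \<epsilon> n *\<^sub>R e)) \<longlonglongrightarrow> H (p y)" if "y \<in> ball x r" for y
    by (rule continuous_on_tendsto_compose[OF H shift_lim in_cl[OF that]])
      (use subsetD[OF closure_subset in_\<Omega>[OF that]] in simp)
  have x: "x \<in> ball x r" using r by simp
  \<comment> \<open>Boundedness of \<Omega> makes \<open>G\<close> uniformly continuous on the
    closure, and the uniform bound \<open>K\<close> on \<open>p'\<close> turns this into uniform
    convergence of the derivatives. The denominator \<open>\<bar>K\<bar> + 1\<close> is positive for
    every \<open>K\<close>.\<close>
  have unif: "\<forall>\<^sub>F n in sequentially. \<forall>y\<in>ball x r. \<forall>h.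
      norm (p' y h \<bullet> G (p y - \<epsilon> n *\<^sub>R e) - p' y h \<bullet> G (p y)) \<le> \<eta> * norm h" if \<eta>: "0 < \<eta>" for \<eta>
  proof -
    have "uniformly_continuous_on (closure \<Omega>) G"
      using G \<open>bounded \<Omega>\<close> by (intro compact_uniformly_continuous) (simp_all add: compact_closure)
    then obtain d where d: "0 < d"
      "\<And>a b. a \<in> closure \<Omega> \<Longrightarrow> b \<in> closure \<Omega> \<Longrightarrow> dist b a < d \<Longrightarrow> dist (G b) (G a) < \<eta> / (\<bar>K\<bar> + 1)"
      unfolding uniformly_continuous_on_def using \<eta>
      by (metis abs_ge_zero add_nonneg_pos divide_pos_pos zero_less_one)
    have "(\<lambda>n. \<epsilon> n * norm e) \<longlonglongrightarrow> 0" by (rule tendsto_eq_intros \<epsilon>_lim | simp)+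
    then have "\<forall>\<^sub>F n in sequentially. \<epsilon> n * norm e < d" using d(1) by (rule order_tendstoD)
    then show ?thesis
    proof (rule eventually_mono, intro ballI allI)
      fix n y and h :: 'b
      assume n: "\<epsilon> n * norm e < d" and y: "y \<in> ball x r"
      let ?a = "p y - \<epsilon> n *\<^sub>R e"
      have "dist ?a (p y) < d" using n \<epsilon>(1)[of n] by (simp add: dist_norm)
      then have *: "norm (G ?a - G (p y)) < \<eta> / (\<bar>K\<bar> + 1)"
        using d(2)[OF in_cl[OF y], of ?a] in_\<Omega>[OF y] closure_subset by (force simp: dist_norm)
      have "norm (p' y h \<bullet> G ?a - p' y h \<bullet> G (p y)) = \<bar>p' y h \<bullet> (G ?a - G (p y))\<bar>"
        by (simp add: inner_diff_right)
      also have "\<dots> \<le> norm (p' y h) * norm (G ?a - G (p y))" by (rule Cauchy_Schwarz_ineq2)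
      also have "\<dots> \<le> ((\<bar>K\<bar> + 1) * norm h) * (\<eta> / (\<bar>K\<bar> + 1))"
      proof (rule mult_mono)
        have "K * norm h \<le> (\<bar>K\<bar> + 1) * norm h" by (intro mult_right_mono) auto
        then show "norm (p' y h) \<le> (\<bar>K\<bar> + 1) * norm h" using p'_le[OF y, of h] by simp
      qed (use * in auto)
      also have "\<dots> = \<eta> * norm h" by (simp add: field_simps)
      finally show "norm (p' y h \<bullet> G ?a - p' y h \<bullet> G (p y)) \<le> \<eta> * norm h" .
    qed
  qed
  have deriv_n: "((\<lambda>y. H (p y - \<epsilon> n *\<^sub>R e)) has_derivative (\<lambda>h. p' y h \<bullet> G (p y - \<epsilon> n *\<^sub>R e)))
      (at y within ball x r)" if y: "y \<in> ball x r" for n y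
  proof -
    have "((\<lambda>y. p y - \<epsilon> n *\<^sub>R e) has_derivative p' y) (at y)"
      using has_derivative_diff[OF dp[OF y] has_derivative_const[of "\<epsilon> n *\<^sub>R e"]] by simp
    from has_derivative_compose[OF this dH[OF in_\<Omega>[OF y], unfolded gderiv_def]]
    show ?thesis by (rule has_derivative_at_withinI)
  qed
  have "\<exists>g. \<forall>y\<in>ball x r. (\<lambda>n. H (p y - \<epsilon> n *\<^sub>R e)) \<longlonglongrightarrow> g y \<and>
      (g has_derivative (\<lambda>h. p' y h \<bullet> G (p y))) (at y within ball x r)"
    by (rule has_derivative_sequence[OF convex_ball deriv_n unif x lim[OF x]])
  then obtain g where g: "\<And>y. y \<in> ball x r \<Longrightarrow> (\<lambda>n. H (p y - \<epsilon> n *\<^sub>R e)) \<longlonglongrightarrow> g y"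
    "\<And>y. y \<in> ball x r \<Longrightarrow> (g has_derivative (\<lambda>h. p' y h \<bullet> G (p y))) (at y within ball x r)"
    by blast
  have "g y = H (p y)" if "y \<in> ball x r" for y
    using LIMSEQ_unique[OF g(1)[OF that] lim[OF that]] .
  note g_eq = this
  have "(g has_derivative (\<lambda>h. p' x h \<bullet> G (p x))) (at x)"
    using g(2)[OF x] at_within_open[OF x open_ball] by simp
  then show ?thesis
    by (rule has_derivative_transform_within_open[OF _ open_ball x g_eq])
qed

section \<open>The boundary as a graph\<close>

locale local_subgraph =
  fixes \<Omega> U :: "(real^'n) set" and e :: "real^'n" and \<phi> :: "real^'n \<Rightarrow> real"
  assumes open_\<Omega>: "open \<Omega>" and open_U: "open U" and norm_e: "norm e = 1"
    and \<phi>_shift: "\<phi> (x + t *\<^sub>R e) = \<phi> x"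
    and \<phi>_C1: "Ck_grad 1 U \<phi>"
    and \<Omega>_U: "\<Omega> \<inter> U = {x \<in> U. x \<bullet> e < \<phi> x}"
begin

definition proj :: "real^'n \<Rightarrow> real^'n" where
  "proj x = x + (\<phi> x - x \<bullet> e) *\<^sub>R e"

definition d\<phi> :: "real^'n \<Rightarrow> real^'n" where
  "d\<phi> x = (\<chi> j. frechet_derivative \<phi> (at x) (axis j 1))"

definition dproj :: "real^'n \<Rightarrow> real^'n \<Rightarrow> real^'n" where
  "dproj x h = h + (h \<bullet> d\<phi> x - h \<bullet> e) *\<^sub>R e"

text \<open>\<open>U\<close> need not be a union of vertical segments, so a point of
  \<open>U\<close> may project outside it, where the graph description says nothing about
  \<Omega>.\<close>

definition U0 :: "(real^'n) set" where
  "U0 = {x \<in> U. proj x \<in> U}"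

lemma e_e: "e \<bullet> e = 1"
  using norm_e by (simp add: dot_square_norm)

lemma \<phi>_shift_diff: "\<phi> (x - t *\<^sub>R e) = \<phi> x"
  using \<phi>_shift[of x "- t"] by simp

lemma \<phi>_proj: "\<phi> (proj x) = \<phi> x"
  by (simp add: proj_def \<phi>_shift)

lemma proj_inner_e: "proj x \<bullet> e = \<phi> x"
  by (simp add: proj_def inner_add_left e_e)

lemma GDERIV_\<phi>: "x \<in> U \<Longrightarrow> GDERIV \<phi> x :> d\<phi> x"
  and continuous_on_d\<phi>: "continuous_on U d\<phi>"
proof -
  obtain g where g: "\<And>j. continuous_on U (\<lambda>x. g x $ j)" "\<And>x. x \<in> U \<Longrightarrow> GDERIV \<phi> x :> g x"
    using \<phi>_C1 by auto
  have eq: "d\<phi> x = g x" if "x \<in> U" for x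
    using GDERIV_frechet_derivative[OF g(2)[OF that]] by (simp add: d\<phi>_def vec_eq_iff)
  show "x \<in> U \<Longrightarrow> GDERIV \<phi> x :> d\<phi> x" using eq g(2) by simp
  have "continuous_on U (\<lambda>x. \<chi> j. g x $ j)" by (intro continuous_on_vec_lambda g)
  then show "continuous_on U d\<phi>" using eq by (simp cong: continuous_on_cong)
qed

lemma has_derivative_proj:
  assumes "x \<in> U"
  shows "(proj has_derivative dproj x) (at x)"
proof -
  have "((\<lambda>x. x + (\<phi> x - x \<bullet> e) *\<^sub>R e) has_derivative (\<lambda>h. h + (h \<bullet> d\<phi> x - h \<bullet> e) *\<^sub>R e)) (at x)"
    using GDERIV_\<phi>[OF assms] unfolding gderiv_def
    by (auto intro!: derivative_eq_intros)
  then show ?thesis unfolding proj_def[abs_def] dproj_def[abs_def] .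
qed

lemma continuous_on_proj: "continuous_on U proj"
  using has_derivative_proj has_derivative_continuous
  by (intro continuous_at_imp_continuous_on) blast

lemma open_U0: "open U0"
proof -
  have "U0 = U \<inter> proj -` U" by (auto simp: U0_def)
  then show ?thesis using continuous_open_preimage[OF continuous_on_proj open_U open_U] by simp
qed

text \<open>The transpose of \<open>dproj x\<close>: it turns the derivative of a function composed
  with \<open>proj\<close> into a gradient.\<close>

lemma dproj_inner: "dproj x h \<bullet> w = h \<bullet> (w + (w \<bullet> e) *\<^sub>R (d\<phi> x - e))"
  by (simp add: dproj_def inner_add_left inner_add_right inner_diff_right inner_commute algebra_simps)

text \<open>\<phi> is constant along \<open>e\<close>, so a descent from the graph lands strictly
  below it; continuity of \<open>proj\<close> keeps the shifted points in \<open>U\<close> with one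
  \<delta> for all \<open>y\<close> near \<open>x\<close>. This uniformity is what the chain rule at
  the boundary asks for.\<close>

lemma proj_shift_inside:
  assumes "x \<in> U0"
  obtains r \<delta> where "0 < r" "0 < \<delta>" "cball x r \<subseteq> U0"
    "\<And>y \<epsilon>. y \<in> cball x r \<Longrightarrow> 0 < \<epsilon> \<Longrightarrow> \<epsilon> \<le> \<delta> \<Longrightarrow> proj y - \<epsilon> *\<^sub>R e \<in> \<Omega>"
proof -
  have x: "x \<in> U" "proj x \<in> U" using assms by (auto simp: U0_def)
  obtain s where s: "0 < s" "ball (proj x) s \<subseteq> U" using open_U x(2) by (meson openE)
  have "isCont proj x" using has_derivative_continuous[OF has_derivative_proj[OF x(1)]] .
  then obtain r1 where r1: "0 < r1" "\<And>y. dist y x < r1 \<Longrightarrow> dist (proj y) (proj x) < s / 2"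
    using s(1) unfolding continuous_at_eps_delta by (meson half_gt_zero)
  obtain r2 where r2: "0 < r2" "cball x r2 \<subseteq> U0"
    using open_U0 assms open_contains_cball by blast
  define r where "r = min (r1 / 2) r2"
  show ?thesis
  proof (rule that[of r "s / 4"])
    fix y \<epsilon> assume y: "y \<in> cball x r" and \<epsilon>: "0 < \<epsilon>" "\<epsilon> \<le> s / 4"
    have "dist (proj y) (proj x) < s / 2"
      by (rule r1(2)) (use y r1(1) in \<open>simp add: r_def dist_commute\<close>)
    moreover have "dist (proj y - \<epsilon> *\<^sub>R e) (proj y) \<le> s / 4" using \<epsilon> norm_e by (simp add: dist_norm)
    ultimately have "dist (proj y - \<epsilon> *\<^sub>R e) (proj x) < s"
      using dist_triangle[of "proj y - \<epsilon> *\<^sub>R e" "proj x" "proj y"] s(1) by linarith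
    then have "proj y - \<epsilon> *\<^sub>R e \<in> U" using s(2) by (auto simp: dist_commute)
    moreover have "(proj y - \<epsilon> *\<^sub>R e) \<bullet> e < \<phi> (proj y - \<epsilon> *\<^sub>R e)"
      using \<epsilon> by (simp add: inner_diff_left proj_inner_e e_e \<phi>_shift_diff \<phi>_proj)
    ultimately show "proj y - \<epsilon> *\<^sub>R e \<in> \<Omega>" using \<Omega>_U by blast
  qed (use r1 r2 s in \<open>auto simp: r_def\<close>)
qed

lemma proj_in_frontier:
  assumes "x \<in> U0"
  shows "proj x \<in> frontier \<Omega>"
proof -
  obtain r \<delta> where r: "0 < r" "0 < \<delta>" "cball x r \<subseteq> U0"
    "\<And>y \<epsilon>. y \<in> cball x r \<Longrightarrow> 0 < \<epsilon> \<Longrightarrow> \<epsilon> \<le> \<delta> \<Longrightarrow> proj y - \<epsilon> *\<^sub>R e \<in> \<Omega>"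
    using proj_shift_inside[OF assms] by metis
  have "\<exists>y\<in>\<Omega>. dist y (proj x) < \<eta>" if "0 < \<eta>" for \<eta>
  proof (rule bexI)
    show "proj x - min \<delta> (\<eta> / 2) *\<^sub>R e \<in> \<Omega>" using r that by simp
    show "dist (proj x - min \<delta> (\<eta> / 2) *\<^sub>R e) (proj x) < \<eta>"
      using that r norm_e by (simp add: dist_norm)
  qed
  then have "proj x \<in> closure \<Omega>" by (simp add: closure_approachable)
  moreover have "proj x \<notin> \<Omega>"
    using \<Omega>_U assms proj_inner_e[of x] \<phi>_proj[of x] unfolding U0_def by force
  ultimately show ?thesis using open_\<Omega> by (simp add: frontier_def interior_open)
qed

text \<open>A frontier point is not below the graph, since \<Omega> is open. It is not strictly
  above either: by continuity of \<phi> a neighbourhood would then miss \<Omega>.\<close>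

lemma frontier_in_U0:
  assumes "x \<in> frontier \<Omega>" "x \<in> U"
  shows "x \<in> U0" "proj x = x"
proof -
  have xc: "x \<in> closure \<Omega>" and xn: "x \<notin> \<Omega>"
    using assms open_\<Omega> by (auto simp: frontier_def interior_open)
  have "\<phi> x \<le> x \<bullet> e" using xn \<Omega>_U assms(2) by force
  moreover have "\<not> \<phi> x < x \<bullet> e"
  proof
    assume lt: "\<phi> x < x \<bullet> e"
    have "isCont \<phi> x"
      using GDERIV_\<phi>[OF assms(2)] has_derivative_continuous unfolding gderiv_def by blast
    then have "((\<lambda>y. y \<bullet> e - \<phi> y) \<longlongrightarrow> x \<bullet> e - \<phi> x) (nhds x)"
      by (intro tendsto_intros) (auto simp: continuous_at tendsto_nhds_iff isCont_def)
    then have "\<forall>\<^sub>F y in nhds x. 0 < y \<bullet> e - \<phi> y"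
      by (rule order_tendstoD) (use lt in simp)
    moreover have "\<forall>\<^sub>F y in nhds x. y \<in> U" using open_U assms(2) by (rule eventually_nhds_in_open)
    ultimately have "\<forall>\<^sub>F y in nhds x. 0 < y \<bullet> e - \<phi> y \<and> y \<in> U" by (rule eventually_conj)
    then obtain S where S: "open S" "x \<in> S" "\<And>y. y \<in> S \<Longrightarrow> 0 < y \<bullet> e - \<phi> y \<and> y \<in> U"
      unfolding eventually_nhds by blast
    then have "S \<inter> \<Omega> \<noteq> {}" using xc by (metis closure_iff_nhds_not_empty open_subset order_refl inf_commute)
    then obtain y where "y \<in> S" "y \<in> \<Omega>" by blast
    then show False using S(3)[of y] \<Omega>_U by force
  qed
  ultimately show p: "proj x = x" by (simp add: proj_def)
  show "x \<in> U0" using p assms by (simp add: U0_def)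
qed

text \<open>\<open>F\<close> composed with \<open>proj\<close> is locally zero, so its gradient,
  computed through the transpose of \<open>dproj\<close>, vanishes. In particular
  \<open>w \<bullet> e = 0\<close> forces \<open>w = 0\<close>.\<close>

lemma implicit_gradient:
  assumes "open V" "x \<in> V" "\<And>y. y \<in> V \<Longrightarrow> F (proj y) = 0"
    and d: "((\<lambda>y. F (proj y)) has_derivative (\<lambda>h. dproj x h \<bullet> w)) (at x)"
  shows "w + (w \<bullet> e) *\<^sub>R (d\<phi> x - e) = 0"
proof -
  have "GDERIV (\<lambda>y. F (proj y)) x :> w + (w \<bullet> e) *\<^sub>R (d\<phi> x - e)"
    using d by (simp add: gderiv_def dproj_inner)
  from GDERIV_cong_open[OF this assms(1,2), of "\<lambda>_. 0"] assms(3)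
  have "GDERIV (\<lambda>_. 0) x :> w + (w \<bullet> e) *\<^sub>R (d\<phi> x - e)" by simp
  then show ?thesis using GDERIV_const GDERIV_unique by blast
qed

lemma has_derivative_comp_proj:
  assumes "bounded \<Omega>" and H: "continuous_on (closure \<Omega>) H" and G: "continuous_on (closure \<Omega>) G"
    and dH: "\<And>x. x \<in> \<Omega> \<Longrightarrow> GDERIV H x :> G x" and x: "x \<in> U0"
  shows "((\<lambda>y. H (proj y)) has_derivative (\<lambda>h. dproj x h \<bullet> G (proj x))) (at x)"
proof -
  obtain r \<delta> where r: "0 < r" "0 < \<delta>" "cball x r \<subseteq> U0"
    "\<And>y \<epsilon>. y \<in> cball x r \<Longrightarrow> 0 < \<epsilon> \<Longrightarrow> \<epsilon> \<le> \<delta> \<Longrightarrow> proj y - \<epsilon> *\<^sub>R e \<in> \<Omega>"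
    using proj_shift_inside[OF x] by metis
  have sub: "cball x r \<subseteq> U" using r(3) by (auto simp: U0_def)
  have "bounded (d\<phi> ` cball x r)"
    by (intro compact_imp_bounded compact_continuous_image continuous_on_subset[OF continuous_on_d\<phi> sub]) auto
  then obtain B where B: "\<And>y. y \<in> cball x r \<Longrightarrow> norm (d\<phi> y) \<le> B"
    unfolding bounded_iff by blast
  have le: "norm (dproj y h) \<le> (B + 2) * norm h" if "y \<in> ball x r" for y h
  proof -
    have "norm (dproj y h) \<le> norm h + \<bar>h \<bullet> (d\<phi> y - e)\<bar>"
      using norm_triangle_ineq[of h "(h \<bullet> d\<phi> y - h \<bullet> e) *\<^sub>R e"] norm_e
      by (simp add: dproj_def inner_diff_right)
    also have "\<bar>h \<bullet> (d\<phi> y - e)\<bar> \<le> norm h * norm (d\<phi> y - e)" by (rule Cauchy_Schwarz_ineq2)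
    also have "\<dots> \<le> norm h * (B + 1)"
      using norm_triangle_ineq4[of "d\<phi> y" e] B[of y] that norm_e by (intro mult_left_mono) auto
    finally show ?thesis by (simp add: algebra_simps)
  qed
  show ?thesis
    by (rule has_derivative_closure_comp[OF assms(1) H G dH r(1) has_derivative_proj le r(2) r(4)])
      (use sub in auto)
qed

text \<open>Solving the gradient identity for \<open>d\<phi>\<close> expresses it through
  \<open>G\<close> at projected points. Each round alternates two gains: the current class of \<phi>
  lifts functions composed with \<open>proj\<close> by one order, and this lifts
  \<open>d\<phi>\<close>, hence \<phi>, by one order.\<close>

lemma Ck_grad_bootstrap:
  assumes bdd: "bounded \<Omega>" and F: "continuous_on (closure \<Omega>) F"
    and dF: "\<And>x. x \<in> \<Omega> \<Longrightarrow> GDERIV F x :> G x"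
    and G: "\<And>i. Ck_grad_closure K \<Omega> (\<lambda>x. G x $ i)"
    and F0: "\<And>x. x \<in> frontier \<Omega> \<Longrightarrow> F x = 0"
  defines "V \<equiv> {x \<in> U0. G (proj x) \<bullet> e \<noteq> 0}"
  shows "open V" and "Ck_grad (Suc K) V \<phi>"
    and "\<And>x. x \<in> U0 \<Longrightarrow> G (proj x) + (G (proj x) \<bullet> e) *\<^sub>R (d\<phi> x - e) = 0"
proof -
  have cl: "proj x \<in> closure \<Omega>" if "x \<in> U0" for x
    using proj_in_frontier[OF that] by (simp add: frontier_def)
  have U0U: "U0 \<subseteq> U" by (auto simp: U0_def)
  have VU0: "V \<subseteq> U0" by (auto simp: V_def)
  have comp_cont: "continuous_on U0 (\<lambda>x. H (proj x))" if "continuous_on (closure \<Omega>) H"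
    for H :: "real^'n \<Rightarrow> 'b::topological_space"
    by (rule continuous_on_compose2[OF that continuous_on_subset[OF continuous_on_proj U0U]])
      (use cl in auto)
  have vec: "continuous_on (closure \<Omega>) g" if "\<And>i. continuous_on (closure \<Omega>) (\<lambda>x. g x $ i)"
    for g :: "real^'n \<Rightarrow> real^'n"
  proof -
    have "continuous_on (closure \<Omega>) (\<lambda>x. \<chi> i. g x $ i)" by (intro continuous_on_vec_lambda that)
    then show ?thesis by simp
  qed
  have Gc: "continuous_on (closure \<Omega>) G"
    by (intro vec Ck_grad_closure_imp_continuous_on[OF G])
  have "continuous_on U0 (\<lambda>x. G (proj x) \<bullet> e)"
    by (intro continuous_intros comp_cont Gc)
  from continuous_open_preimage[OF this open_U0, of "- {0}"]
  show oV: "open V" by (simp add: V_def Int_def vimage_def open_Compl)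
  show grad: "G (proj x) + (G (proj x) \<bullet> e) *\<^sub>R (d\<phi> x - e) = 0" if "x \<in> U0" for x
    by (rule implicit_gradient[OF open_U0 that _ has_derivative_comp_proj[OF bdd F Gc dF that]])
      (use F0 proj_in_frontier in auto)
  have d\<phi>_eq: "d\<phi> x $ i = e $ i - G (proj x) $ i * inverse (G (proj x) \<bullet> e)" if "x \<in> V" for x i
  proof -
    have x: "x \<in> U0" "G (proj x) \<bullet> e \<noteq> 0" using that by (auto simp: V_def)
    have "(G (proj x) + (G (proj x) \<bullet> e) *\<^sub>R (d\<phi> x - e)) $ i = 0" using grad[OF x(1)] by simp
    then have "(G (proj x) \<bullet> e) * (d\<phi> x $ i - e $ i) = - G (proj x) $ i" by simp
    then have "d\<phi> x $ i - e $ i = - G (proj x) $ i * inverse (G (proj x) \<bullet> e)"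
      using x(2) by (simp add: field_simps)
    then show ?thesis by simp
  qed
  \<comment> \<open>The statement about all \<open>H\<close> is carried along because the step
    applies it to the gradient components of \<open>H\<close>; the \<open>C^1\<close> regularity of
    \<phi> starts the induction.\<close>
  have main: "(\<forall>H. Ck_grad_closure k \<Omega> H \<longrightarrow> Ck_grad k V (\<lambda>x. H (proj x))) \<and> Ck_grad (Suc k) V \<phi>"
    if "k \<le> K" for k
    using that
  proof (induction k)
    case 0
    have "continuous_on V (\<lambda>x. H (proj x))" if "continuous_on (closure \<Omega>) H" for H :: "real^'n \<Rightarrow> real"
      using comp_cont[OF that] VU0 by (rule continuous_on_subset)
    moreover have "Ck_grad 1 V \<phi>" by (rule Ck_grad_subset[OF \<phi>_C1 subset_trans[OF VU0 U0U]])
    ultimately show ?case by simp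
  next
    case (Suc k)
    then have IH: "\<And>H. Ck_grad_closure k \<Omega> H \<Longrightarrow> Ck_grad k V (\<lambda>x. H (proj x))"
      and \<phi>: "Ck_grad (Suc k) V \<phi>" by auto
    from \<phi> obtain g where g: "\<And>j. Ck_grad k V (\<lambda>x. g x $ j)" "\<And>x. x \<in> V \<Longrightarrow> GDERIV \<phi> x :> g x"
      by auto
    have gd: "g x = d\<phi> x" if "x \<in> V" for x
      using GDERIV_unique[OF g(2)[OF that] GDERIV_\<phi>] that VU0 U0U by auto
    have d\<phi>_k: "Ck_grad k V (\<lambda>x. d\<phi> x $ j)" for j
      by (rule Ck_grad_cong[OF g(1) oV]) (simp add: gd)
    have comp: "Ck_grad (Suc k) V (\<lambda>x. H (proj x))" if "Ck_grad_closure (Suc k) \<Omega> H" for H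
    proof -
      from that obtain GH where H: "continuous_on (closure \<Omega>) H"
        and GH: "\<And>j. Ck_grad_closure k \<Omega> (\<lambda>x. GH x $ j)" "\<And>x. x \<in> \<Omega> \<Longrightarrow> GDERIV H x :> GH x"
        by auto
      define D where "D x = GH (proj x) + (GH (proj x) \<bullet> e) *\<^sub>R (d\<phi> x - e)" for x
      have "Ck_grad k V (\<lambda>x. GH (proj x) $ j + (\<Sum>i\<in>UNIV. GH (proj x) $ i * e $ i) * (d\<phi> x $ j - e $ j))" for j
        by (intro Ck_grad_add Ck_grad_mult Ck_grad_sum Ck_grad_diff Ck_grad_const d\<phi>_k IH[OF GH(1)])
      then have "Ck_grad k V (\<lambda>x. D x $ j)" for j by (simp add: D_def inner_vec_def)
      moreover have "GDERIV (\<lambda>x. H (proj x)) x :> D x" if "x \<in> V" for x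
      proof -
        have "continuous_on (closure \<Omega>) GH"
          by (intro vec Ck_grad_closure_imp_continuous_on[OF GH(1)])
        from has_derivative_comp_proj[OF bdd H this GH(2)] show ?thesis
          using that VU0 by (auto simp: gderiv_def D_def dproj_inner[symmetric])
      qed
      ultimately show ?thesis by auto
    qed
    have GK: "Ck_grad_closure (Suc k) \<Omega> (\<lambda>x. G x $ i)" for i
      using Suc.prems G[of i]
      by (induction rule: inc_induct) (auto intro: Ck_grad_closure_SucD simp del: Ck_grad_closure.simps)
    have "Ck_grad (Suc k) V (\<lambda>x. e $ j - G (proj x) $ j * inverse (\<Sum>i\<in>UNIV. G (proj x) $ i * e $ i))" for j
      by (intro Ck_grad_diff Ck_grad_mult Ck_grad_inverse Ck_grad_sum Ck_grad_const comp[OF GK])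
        (auto simp: V_def inner_vec_def)
    then have "Ck_grad (Suc k) V (\<lambda>x. d\<phi> x $ j)" for j
      by (rule Ck_grad_cong[OF _ oV]) (simp add: d\<phi>_eq inner_vec_def)
    moreover have "GDERIV \<phi> x :> d\<phi> x" if "x \<in> V" for x
      using GDERIV_\<phi> that VU0 U0U by auto
    ultimately have "Ck_grad (Suc (Suc k)) V \<phi>" by (subst Ck_grad.simps) blast
    then show ?case using comp by blast
  qed
  then show "Ck_grad (Suc K) V \<phi>" by blast
qed

lemma boundary_regular_nearI:
  assumes "open V" "V \<subseteq> U" "x0 \<in> V" "R V \<phi>"
  shows "boundary_regular_near R \<Omega> x0"
  unfolding boundary_regular_near_def
proof (intro exI conjI)
  show "\<Omega> \<inter> V = {x \<in> V. x \<bullet> e < \<phi> x}" using \<Omega>_U assms(2) by auto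
qed (use assms norm_e \<phi>_shift in auto)

text \<open>\<open>u\<close> lives on both sides of the boundary, so the ordinary chain rule
  applies. Near each point of \<open>V\<close> the function \<phi> solves an analytic equation with
  nonzero derivative in direction \<open>e\<close>.\<close>

lemma analytic_bootstrap:
  assumes W: "open W" and u: "real_analytic_on W u"
    and u0: "\<And>x. x \<in> frontier \<Omega> \<Longrightarrow> x \<in> W \<Longrightarrow> u x = 0"
  defines "du \<equiv> \<lambda>x. \<chi> j. partial j u x"
  defines "V \<equiv> {x \<in> U0. proj x \<in> W \<and> du (proj x) \<bullet> e \<noteq> 0}"
  shows "open V" and "real_analytic_on V \<phi>"
    and "\<And>x. x \<in> U0 \<Longrightarrow> proj x \<in> W \<Longrightarrow> du (proj x) + (du (proj x) \<bullet> e) *\<^sub>R (d\<phi> x - e) = 0"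
proof -
  define V1 where "V1 = {x \<in> U0. proj x \<in> W}"
  have U0U: "U0 \<subseteq> U" by (auto simp: U0_def)
  have proj_cont: "continuous_on U0 proj"
    using continuous_on_proj U0U by (rule continuous_on_subset)
  have "V1 = U0 \<inter> proj -` W" by (auto simp: V1_def)
  then have oV1: "open V1" using continuous_open_preimage[OF proj_cont open_U0 W] by simp
  have zero: "u (proj x) = 0" if "x \<in> V1" for x
    using that u0 proj_in_frontier by (auto simp: V1_def)
  have du: "GDERIV u x :> du x" if "x \<in> W" for x
    using real_analytic_on_has_derivative[OF u that] by (simp add: gderiv_def du_def inner_vec_def)
  have "continuous_on W du"
    unfolding du_def by (intro continuous_on_vec_lambda real_analytic_on_continuous_partial[OF u])
  then have "continuous_on V1 (\<lambda>x. du (proj x) \<bullet> e)"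
    by (intro continuous_intros continuous_on_compose2[of W du V1 proj] continuous_on_subset[OF proj_cont])
      (auto simp: V1_def)
  from continuous_open_preimage[OF this oV1, of "- {0}"]
  have "open (V1 \<inter> (\<lambda>x. du (proj x) \<bullet> e) -` (- {0}))" by (simp add: open_Compl)
  moreover have "V = V1 \<inter> (\<lambda>x. du (proj x) \<bullet> e) -` (- {0})" by (auto simp: V_def V1_def)
  ultimately show oV: "open V" by simp
  show "du (proj x) + (du (proj x) \<bullet> e) *\<^sub>R (d\<phi> x - e) = 0" if "x \<in> U0" "proj x \<in> W" for x
  proof (rule implicit_gradient[where F=u, OF oV1 _ zero])
    show "x \<in> V1" using that by (simp add: V1_def)
    show "((\<lambda>y. u (proj y)) has_derivative (\<lambda>h. dproj x h \<bullet> du (proj x))) (at x)"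
      using has_derivative_compose[OF has_derivative_proj du[OF that(2), unfolded gderiv_def]] that(1) U0U
      by auto
  qed
  show "real_analytic_on V \<phi>"
  proof (rule real_analytic_onI[OF oV])
    fix x assume x: "x \<in> V"
    then have x1: "x \<in> V1" and xW: "proj x \<in> W" and xU: "x \<in> U" and De: "du (proj x) \<bullet> e \<noteq> 0"
      using U0U by (auto simp: V_def V1_def)
    obtain R c where R: "0 < R" and c: "has_ps R c (\<lambda>v. u (proj x + v))"
      using real_analytic_on_has_ps[OF u xW] by metis
    \<comment> \<open>Recentred at \<open>x\<close> below and at \<open>proj x\<close> in the
      target, \<open>s\<close> satisfies the implicit equation because
      \<open>proj x + (v + (s v - v \<bullet> e) *\<^sub>R e)\<close> equals
      \<open>proj (x + v)\<close>.\<close>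
    define s where "s v = \<phi> (x + v) - \<phi> x" for v
    have "\<exists>r>0. \<exists>M. ps_bounded r M s"
    proof (rule analytic_implicit_function[OF c R _ norm_e])
      show "u (proj x + 0) = 0" using zero[OF x1] by simp
      show "(\<Sum>i\<in>UNIV. c (unit_index i) * e $ i) \<noteq> 0"
        using De has_ps_partial[OF c R] by (simp add: du_def inner_vec_def)
      have "isCont \<phi> x"
        using GDERIV_\<phi>[OF xU] has_derivative_continuous unfolding gderiv_def by blast
      then have "(\<lambda>v. \<phi> (x + v)) \<midarrow>0\<rightarrow> \<phi> x" by (simp only: isCont_iff)
      then have "(\<lambda>v. \<phi> (x + v) - \<phi> x) \<midarrow>0\<rightarrow> \<phi> x - \<phi> x"
        by (intro tendsto_diff tendsto_const)
      then show "isCont s 0" by (simp add: isCont_def s_def[abs_def])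
      show "s 0 = 0" by (simp add: s_def)
      have "\<forall>\<^sub>F v in nhds 0. x + v \<in> V1"
      proof -
        have "((\<lambda>v. x + v) \<longlongrightarrow> x + 0) (nhds 0)"
          by (intro tendsto_add tendsto_const) (simp add: filterlim_ident)
        then have "((\<lambda>v. x + v) \<longlongrightarrow> x) (nhds 0)" by simp
        then show ?thesis using oV1 x1 by (rule topological_tendstoD)
      qed
      then show "\<forall>\<^sub>F v in nhds 0. u (proj x + (v + (s v - v \<bullet> e) *\<^sub>R e)) = 0"
      proof (rule eventually_mono)
        fix v assume v: "x + v \<in> V1"
        have "proj x + (v + (s v - v \<bullet> e) *\<^sub>R e) = proj (x + v)"
          by (simp add: proj_def s_def inner_add_left algebra_simps)
        then show "u (proj x + (v + (s v - v \<bullet> e) *\<^sub>R e)) = 0" using zero[OF v] by simp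
      qed
    qed
    then obtain r M where r: "0 < r" "ps_bounded r M s" by blast
    have "ps_bounded r (M + \<bar>\<phi> x\<bar>) (\<lambda>v. s v + \<phi> x)"
      by (intro ps_bounded_add r ps_bounded_const)
    then have "ps_bounded r (M + \<bar>\<phi> x\<bar>) (\<lambda>v. \<phi> (x + v))" by (simp add: s_def)
    then show "\<exists>r>0. \<exists>M. ps_bounded r M (\<lambda>v. \<phi> (x + v))" using r(1) by blast
  qed
qed

end

section \<open>The displacement at the boundary\<close>

lemma jacobian_nth:
  fixes f :: "real^'n \<Rightarrow> real^'m"
  assumes "\<And>i. GDERIV (\<lambda>y. f y $ i) x :> G i"
  shows "jacobian f (at x) $ i $ j = G i $ j"
proof -
  have "(f has_derivative (\<lambda>h. \<chi> i. h \<bullet> G i)) (at x)"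
    by (subst has_derivative_componentwise_within)
      (use assms in \<open>auto simp: Basis_vec_def inner_axis gderiv_def\<close>)
  then have "frechet_derivative f (at x) = (\<lambda>h. \<chi> i. h \<bullet> G i)"
    by (rule frechet_derivative_at[symmetric])
  then show ?thesis by (simp add: jacobian_def matrix_def inner_axis')
qed

text \<open>A point of the closure outside \<Omega> is a limit point of \<Omega>, so the limit
  defining the boundary Jacobian is unique and can be found entrywise.\<close>

lemma closure_jacobian_eqI:
  assumes x0: "x0 \<in> closure \<Omega>" "x0 \<notin> \<Omega>"
    and lim: "\<And>i j. ((\<lambda>y. jacobian \<Psi> (at y) $ i $ j) \<longlongrightarrow> A $ i $ j) (at x0 within \<Omega>)"
  shows "closure_jacobian \<Omega> \<Psi> x0 = A"
  unfolding closure_jacobian_def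
proof (rule tendsto_Lim)
  show "\<not> trivial_limit (at x0 within \<Omega>)"
    using x0 by (simp add: trivial_limit_within closure_def)
  show "((\<lambda>y. jacobian \<Psi> (at y)) \<longlongrightarrow> A) (at x0 within \<Omega>)"
    by (intro vec_tendstoI lim)
qed

lemma GDERIV_coord: "GDERIV (\<lambda>x. x $ i) x :> axis i 1"
  by (simp add: gderiv_def inner_axis bounded_linear_imp_has_derivative bounded_linear_vec_nth)

text \<open>Row i of the difference is the gradient of the i-th component of the displacement; this
  picks the component playing the role of \<open>F\<close>.\<close>

lemma matrix_minus_id_nonzero:
  fixes A :: "real^'n^'n"
  assumes "(A - mat 1) *v w \<noteq> 0"
  obtains i where "A $ i - axis i 1 \<noteq> 0"
proof -
  have "A \<noteq> mat 1" using assms by auto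
  then obtain i where "A $ i \<noteq> mat 1 $ i" by (auto simp: vec_eq_iff[of A])
  moreover have "(mat 1 :: real^'n^'n) $ i = axis i 1" by (simp add: mat_def axis_def vec_eq_iff)
  ultimately show ?thesis using that[of i] by simp
qed

lemma local_subgraph_near_boundary:
  assumes "C1_holder_domain \<alpha> \<Omega>" "x0 \<in> frontier \<Omega>"
  obtains U e \<phi> where "local_subgraph \<Omega> U e \<phi>" "x0 \<in> U"
proof -
  have "boundary_regular_near (Ck_holder_on 1 \<alpha>) \<Omega> x0" and op: "open \<Omega>"
    using assms by (auto simp: C1_holder_domain_def)
  then obtain U e \<phi> where U: "open U" "x0 \<in> U" "norm e = 1" "\<forall>x t. \<phi> (x + t *\<^sub>R e) = \<phi> x"
    "Ck_holder_on 1 \<alpha> U \<phi>" "\<Omega> \<inter> U = {x \<in> U. x \<bullet> e < \<phi> x}"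
    unfolding boundary_regular_near_def by blast
  have "Ck_grad 1 U \<phi>" using U(5) by (intro Ck_on_1_imp_Ck_grad) (simp add: Ck_holder_on_def)
  then have "local_subgraph \<Omega> U e \<phi>" by unfold_locales (use U op in auto)
  then show ?thesis using that U(2) by blast
qed

text \<open>The set \<open>N\<close> of orders serves finite and infinite smoothness together.
  \<open>V\<close> depends only on the first-order extensions \<open>g [j]\<close>, so one
  neighbourhood works for all orders in \<open>N\<close>, as the smooth case requires.\<close>

lemma boundary_graph_Ck_grad:
  fixes \<Psi> :: "real^'n \<Rightarrow> real^'n"
  assumes dom: "C1_holder_domain \<alpha> \<Omega>" and bdd: "bounded \<Omega>"
    and id: "\<And>x. x \<in> frontier \<Omega> \<Longrightarrow> \<Psi> x = x" and x0: "x0 \<in> frontier \<Omega>"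
    and nz: "(closure_jacobian \<Omega> \<Psi> x0 - mat 1) *v w \<noteq> 0"
    and cont: "continuous_on (closure \<Omega>) \<Psi>"
    and g: "\<And>k ks. k \<in> N \<Longrightarrow> length ks \<le> Suc k \<Longrightarrow> continuous_on (closure \<Omega>) (g ks)"
      "\<And>k ks x. k \<in> N \<Longrightarrow> length ks \<le> Suc k \<Longrightarrow> x \<in> \<Omega> \<Longrightarrow> g ks x = iter_partial ks \<Psi> x"
    and \<Psi>: "\<And>k. k \<in> N \<Longrightarrow> Ck_on (Suc k) \<Omega> \<Psi>"
    and N: "N \<noteq> {}"
  obtains U e \<phi> V where "local_subgraph \<Omega> U e \<phi>" "open V" "V \<subseteq> U" "x0 \<in> V"
    "\<And>k. k \<in> N \<Longrightarrow> Ck_grad (Suc k) V \<phi>"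
proof -
  have op: "open \<Omega>" using dom by (simp add: C1_holder_domain_def)
  obtain U e \<phi> where "local_subgraph \<Omega> U e \<phi>" and x0U: "x0 \<in> U"
    using local_subgraph_near_boundary[OF dom x0] by blast
  then interpret local_subgraph \<Omega> U e \<phi> by simp
  obtain k0 where k0: "k0 \<in> N" using N by blast
  define M where "M x i = (\<chi> j. g [j] x $ i)" for x i
  have dM: "GDERIV (\<lambda>y. \<Psi> y $ i) x :> M x i" if x: "x \<in> \<Omega>" for x i
  proof -
    have "\<Psi> differentiable (at x)"
      using \<Psi>[OF k0] x unfolding Ck_on_def by (metis iter_partial.simps(1) list.size(3) zero_less_Suc)
    from differentiable_imp_GDERIV_nth[OF this, of i] show ?thesis
      using g(2)[OF k0 _ x] by (simp add: M_def)
  qed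
  have Mc: "continuous_on (closure \<Omega>) (\<lambda>x. M x i $ j)" for i j
    using g(1)[OF k0, of "[j]"] by (simp add: M_def continuous_on_component)
  have x0c: "x0 \<in> closure \<Omega>" "x0 \<notin> \<Omega>"
    using x0 op by (auto simp: frontier_def interior_open)
  have "closure_jacobian \<Omega> \<Psi> x0 = (\<chi> i. M x0 i)"
  proof (rule closure_jacobian_eqI[OF x0c])
    fix i j
    have "((\<lambda>y. M y i $ j) \<longlongrightarrow> M x0 i $ j) (at x0 within \<Omega>)"
      using Mc[of i j] x0c(1) closure_subset unfolding continuous_on_def by (meson tendsto_within_subset)
    then have "((\<lambda>y. jacobian \<Psi> (at y) $ i $ j) \<longlongrightarrow> M x0 i $ j) (at x0 within \<Omega>)"
      by (rule Lim_transform_within[OF _ zero_less_one]) (simp add: jacobian_nth[OF dM])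
    then show "((\<lambda>y. jacobian \<Psi> (at y) $ i $ j) \<longlongrightarrow> (\<chi> i. M x0 i) $ i $ j) (at x0 within \<Omega>)"
      by simp
  qed
  then obtain i where i: "M x0 i - axis i 1 \<noteq> 0"
    using matrix_minus_id_nonzero[OF nz] by auto
  define F where "F x = \<Psi> x $ i - x $ i" for x
  define G where "G x = M x i - axis i 1" for x
  have Fc: "continuous_on (closure \<Omega>) F"
    unfolding F_def by (intro continuous_intros cont)
  have dF: "GDERIV F x :> G x" if "x \<in> \<Omega>" for x
    unfolding F_def[abs_def] G_def by (intro GDERIV_diff dM that GDERIV_coord)
  have F0: "F x = 0" if "x \<in> frontier \<Omega>" for x
    using id[OF that] by (simp add: F_def)
  have GK: "Ck_grad_closure k \<Omega> (\<lambda>x. G x $ j)" if k: "k \<in> N" for k j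
  proof -
    have "Ck_grad_closure k \<Omega> (\<lambda>x. g [j] x $ i)"
      by (rule Ck_grad_closure_of_partials[OF op \<Psi>[OF k] g(1)[OF k] g(2)[OF k]]) auto
    from Ck_grad_closure_diff_const[OF this, of "axis i 1 $ j"] show ?thesis
      by (simp add: G_def M_def)
  qed
  define V where "V = {x \<in> U0. G (proj x) \<bullet> e \<noteq> 0}"
  have boot: "open V" "Ck_grad (Suc k) V \<phi>"
    "\<And>x. x \<in> U0 \<Longrightarrow> G (proj x) + (G (proj x) \<bullet> e) *\<^sub>R (d\<phi> x - e) = 0" if "k \<in> N" for k
    unfolding V_def by (rule Ck_grad_bootstrap[OF bdd Fc dF GK[OF that] F0]; assumption)+
  have x00: "x0 \<in> U0" "proj x0 = x0" using frontier_in_U0[OF x0 x0U] by auto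
  have "G x0 \<bullet> e \<noteq> 0"
    using boot(3)[OF k0 x00(1)] i by (auto simp: x00 G_def)
  then have "x0 \<in> V" using x00 by (simp add: V_def)
  moreover have "V \<subseteq> U" by (auto simp: V_def U0_def)
  ultimately show ?thesis using that local_subgraph_axioms boot(1)[OF k0] boot(2) by blast
qed

text \<open>Taking a component is bounded and linear, so it passes to the coefficients; the
  subtracted coordinate is a polynomial in the increment.\<close>

lemma real_analytic_on_displacement:
  fixes f :: "real^'n \<Rightarrow> real^'n"
  assumes "open W" "real_analytic_on W f"
  shows "real_analytic_on W (\<lambda>x. f x $ i - x $ i)"
proof (rule real_analytic_onI[OF assms(1)])
  fix x assume x: "x \<in> W"
  have "real_analytic_on W (\<lambda>x. f x $ i)"
    unfolding real_analytic_on_def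
  proof
    fix x assume "x \<in> W"
    then obtain r c where r: "0 < r" "ball x r \<subseteq> W"
      and c: "\<And>y. y \<in> ball x r \<Longrightarrow>
         ((\<lambda>a. (\<Prod>i\<in>UNIV. (y $ i - x $ i) ^ a i) *\<^sub>R c a) has_sum f y) UNIV"
      using assms(2) unfolding real_analytic_on_def by blast
    have "((\<lambda>a. (\<Prod>i\<in>UNIV. (y $ i - x $ i) ^ a i) *\<^sub>R (c a $ i)) has_sum f y $ i) UNIV"
      if "y \<in> ball x r" for y
      using has_sum_bounded_linear[OF bounded_linear_vec_nth c[OF that], of i] by simp
    then show "\<exists>r>0. \<exists>c. ball x r \<subseteq> W \<and> (\<forall>y\<in>ball x r.
         ((\<lambda>a. (\<Prod>i\<in>UNIV. (y $ i - x $ i) ^ a i) *\<^sub>R c a) has_sum f y $ i) UNIV)"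
      using r by (intro exI[of _ r] conjI exI[of _ "\<lambda>a. c a $ i"]) auto
  qed
  from real_analytic_on_has_ps[OF this x] obtain R c
    where R: "0 < R" and c: "has_ps R c (\<lambda>v. f (x + v) $ i)" by metis
  then have "ps_bounded R (\<Sum>\<^sub>\<infinity>a. \<bar>c a\<bar> * R ^ deg a) (\<lambda>v. f (x + v) $ i)"
    by (auto simp: ps_bounded_def)
  then have "ps_bounded R ((\<Sum>\<^sub>\<infinity>a. \<bar>c a\<bar> * R ^ deg a) + (\<bar>x $ i\<bar> + R))
      (\<lambda>v. f (x + v) $ i - (x $ i + v $ i))"
    by (intro ps_bounded_diff ps_bounded_add ps_bounded_const ps_bounded_coord) (use R in auto)
  then show "\<exists>r>0. \<exists>M. ps_bounded r M (\<lambda>v. f (x + v) $ i - (x + v) $ i)"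
    using R by auto
qed

text \<open>The local analytic extension \<open>f\<close> agrees with \<Psi> on the closure. So the
  Jacobians coincide in \<Omega> near \<open>x0\<close> and have the same limit, and a component of
  \<open>f\<close> minus the coordinate vanishes on the nearby boundary.\<close>

lemma boundary_graph_analytic:
  fixes \<Psi> :: "real^'n \<Rightarrow> real^'n"
  assumes dom: "C1_holder_domain \<alpha> \<Omega>"
    and id: "\<And>x. x \<in> frontier \<Omega> \<Longrightarrow> \<Psi> x = x" and x0: "x0 \<in> frontier \<Omega>"
    and nz: "(closure_jacobian \<Omega> \<Psi> x0 - mat 1) *v w \<noteq> 0"
    and \<Psi>: "real_analytic_closure \<Omega> \<Psi>"
  shows "boundary_regular_near real_analytic_on \<Omega> x0"
proof -
  have op: "open \<Omega>" using dom by (simp add: C1_holder_domain_def)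
  obtain U e \<phi> where "local_subgraph \<Omega> U e \<phi>" and x0U: "x0 \<in> U"
    using local_subgraph_near_boundary[OF dom x0] by blast
  then interpret local_subgraph \<Omega> U e \<phi> by simp
  have x0c: "x0 \<in> closure \<Omega>" "x0 \<notin> \<Omega>"
    using x0 op by (auto simp: frontier_def interior_open)
  obtain W f where W: "open W" "x0 \<in> W" and f: "real_analytic_on W f"
    and eq: "\<And>y. y \<in> closure \<Omega> \<Longrightarrow> y \<in> W \<Longrightarrow> \<Psi> y = f y"
    using bspec[OF \<Psi>[unfolded real_analytic_closure_def] x0c(1)] by auto
  define u where "u i x = f x $ i - x $ i" for i x
  have u: "real_analytic_on W (u i)" for i
    unfolding u_def[abs_def] by (rule real_analytic_on_displacement[OF W(1) f])
  define du where "du i x = (\<chi> j. partial j (u i) x)" for i x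
  have d\<Psi>: "GDERIV (\<lambda>y. \<Psi> y $ i) x :> du i x + axis i 1" if x: "x \<in> \<Omega> \<inter> W" for x i
  proof -
    have "GDERIV (u i) x :> du i x"
      using real_analytic_on_has_derivative[OF u] x by (simp add: gderiv_def du_def inner_vec_def)
    from GDERIV_add[OF this GDERIV_coord[of i x]]
    have "GDERIV (\<lambda>y. f y $ i) x :> du i x + axis i 1" by (simp add: u_def)
    then show ?thesis
      by (rule GDERIV_cong_open[OF _ open_Int[OF op W(1)] x]) (use eq subsetD[OF closure_subset[of \<Omega>]] in auto)
  qed
  have "closure_jacobian \<Omega> \<Psi> x0 = (\<chi> i. du i x0 + axis i 1)"
  proof (rule closure_jacobian_eqI[OF x0c])
    fix i j
    have "isCont (partial j (u i)) x0"
      using real_analytic_on_continuous_partial[OF u] W by (simp add: continuous_on_eq_continuous_at)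
    then have "((\<lambda>y. partial j (u i) y + axis i 1 $ j) \<longlongrightarrow> partial j (u i) x0 + axis i 1 $ j) (at x0 within \<Omega>)"
      by (intro tendsto_intros) (auto simp: isCont_def intro: tendsto_within_subset)
    moreover have "\<forall>\<^sub>F y in at x0 within \<Omega>. y \<in> W"
      using eventually_nhds_in_open[OF W] by (auto simp: eventually_at_filter elim: eventually_mono)
    then have "\<forall>\<^sub>F y in at x0 within \<Omega>.
        partial j (u i) y + axis i 1 $ j = jacobian \<Psi> (at y) $ i $ j"
      unfolding eventually_at_filter
      by (rule eventually_mono) (auto simp: jacobian_nth[OF d\<Psi>] du_def)
    ultimately show "((\<lambda>y. jacobian \<Psi> (at y) $ i $ j) \<longlongrightarrow> (\<chi> i. du i x0 + axis i 1) $ i $ j) (at x0 within \<Omega>)"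
      using Lim_transform_eventually by (fastforce simp: du_def)
  qed
  then obtain i where i: "du i x0 \<noteq> 0"
    using matrix_minus_id_nonzero[OF nz] by auto
  have u0: "u i x = 0" if "x \<in> frontier \<Omega>" "x \<in> W" for x
    using id[OF that(1)] eq[of x] that by (simp add: u_def frontier_def)
  define V where "V = {x \<in> U0. proj x \<in> W \<and> du i (proj x) \<bullet> e \<noteq> 0}"
  have boot: "open V" "real_analytic_on V \<phi>"
    "\<And>x. x \<in> U0 \<Longrightarrow> proj x \<in> W \<Longrightarrow> du i (proj x) + (du i (proj x) \<bullet> e) *\<^sub>R (d\<phi> x - e) = 0"
    unfolding V_def du_def by (rule analytic_bootstrap[OF W(1) u[of i] u0]; assumption)+
  have x00: "x0 \<in> U0" "proj x0 = x0" using frontier_in_U0[OF x0 x0U] by auto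
  have "du i x0 \<bullet> e \<noteq> 0"
    using boot(3)[OF x00(1)] i W(2) by (auto simp: x00)
  then have "x0 \<in> V" using x00 W(2) by (simp add: V_def)
  moreover have "V \<subseteq> U" by (auto simp: V_def U0_def)
  ultimately show ?thesis using boot(1,2) by (intro boundary_regular_nearI)
qed

theorem proposition3p6:
  fixes \<Omega> :: "(real^'n) set"
    and \<Psi> :: "real^'n \<Rightarrow> real^'n"
    and \<nu> :: "real^'n \<Rightarrow> real^'n"
    and \<alpha> :: real and m :: nat
  assumes "CARD('n) \<ge> 2"
    and "0 < \<alpha>" and "\<alpha> < 1"
    and "m \<ge> 1"
    and "bounded \<Omega>" and "C1_holder_domain \<alpha> \<Omega>"
    and "connected (- closure \<Omega>)"
    and "\<forall>x\<in>frontier \<Omega>. \<Psi> x = x"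
    and "\<forall>x\<in>frontier \<Omega>. outward_unit_normal \<Omega> x (\<nu> x)"
  shows "(diffeo_on_closure (Ck_closure (m + 2)) \<Omega> \<Psi> \<longrightarrow>
            (\<forall>x0\<in>frontier \<Omega>. \<not> boundary_regular_near (Ck_holder_on m \<alpha>) \<Omega> x0 \<longrightarrow>
               (closure_jacobian \<Omega> \<Psi> x0 - mat 1) *v \<nu> x0 = 0)) \<and>
         (diffeo_on_closure Cinf_closure \<Omega> \<Psi> \<longrightarrow>
            (\<forall>x0\<in>frontier \<Omega>. \<not> boundary_regular_near Cinf_on \<Omega> x0 \<longrightarrow>
               (closure_jacobian \<Omega> \<Psi> x0 - mat 1) *v \<nu> x0 = 0)) \<and>
         (diffeo_on_closure real_analytic_closure \<Omega> \<Psi> \<longrightarrow>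
            (\<forall>x0\<in>frontier \<Omega>. \<not> boundary_regular_near real_analytic_on \<Omega> x0 \<longrightarrow>
               (closure_jacobian \<Omega> \<Psi> x0 - mat 1) *v \<nu> x0 = 0))"
proof (intro conjI impI ballI; rule ccontr)
  fix x0
  assume "diffeo_on_closure (Ck_closure (m + 2)) \<Omega> \<Psi>" and x0: "x0 \<in> frontier \<Omega>"
    and nreg: "\<not> boundary_regular_near (Ck_holder_on m \<alpha>) \<Omega> x0"
    and nz: "(closure_jacobian \<Omega> \<Psi> x0 - mat 1) *v \<nu> x0 \<noteq> 0"
  then have cont: "continuous_on (closure \<Omega>) \<Psi>" and \<Psi>: "Ck_on (m + 2) \<Omega> \<Psi>"
    and "\<forall>ks. \<exists>g. length ks \<le> m + 2 \<longrightarrow>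
       continuous_on (closure \<Omega>) g \<and> (\<forall>x\<in>\<Omega>. g x = iter_partial ks \<Psi> x)"
    by (auto simp: diffeo_on_closure_def Ck_closure_def)
  from choice[OF this(3)] obtain g where g: "\<And>ks. length ks \<le> m + 2 \<Longrightarrow>
       continuous_on (closure \<Omega>) (g ks) \<and> (\<forall>x\<in>\<Omega>. g ks x = iter_partial ks \<Psi> x)"
    by blast
  \<comment> \<open>With \<Psi> of class C^(m+2), its gradient is of class C^(m+1) up to the
    boundary, hence the order \<open>m + 1\<close>; the bootstrap returns one order more for
    \<phi>.\<close>
  obtain U e \<phi> V where G: "local_subgraph \<Omega> U e \<phi>" and V: "open V" "V \<subseteq> U" "x0 \<in> V"
    and \<phi>: "Ck_grad (Suc (m + 1)) V \<phi>"
    by (rule boundary_graph_Ck_grad[OF assms(6,5) _ x0 nz cont, where N="{m + 1}" and g=g])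
      (use assms(8) g \<Psi> in auto)
  obtain r where r: "0 < r" "cball x0 r \<subseteq> V" using V open_contains_cball by blast
  \<comment> \<open>The Hoelder bound is taken on a ball whose closure lies in \<open>V\<close>,
    since derivatives need not be bounded on \<open>V\<close> itself.\<close>
  have "Ck_holder_on m \<alpha> (ball x0 r) \<phi>"
    by (rule Ck_grad_imp_Ck_holder_on_ball[OF V(1) Ck_grad_mono[OF \<phi>] r(2)])
      (use assms in auto)
  moreover have "ball x0 r \<subseteq> U" using r(2) V(2) ball_subset_cball by blast
  ultimately have "boundary_regular_near (Ck_holder_on m \<alpha>) \<Omega> x0"
    using r(1) by (intro local_subgraph.boundary_regular_nearI[OF G open_ball]) auto
  with nreg show False ..
next
  fix x0
  assume "diffeo_on_closure Cinf_closure \<Omega> \<Psi>" and x0: "x0 \<in> frontier \<Omega>"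
    and nreg: "\<not> boundary_regular_near Cinf_on \<Omega> x0"
    and nz: "(closure_jacobian \<Omega> \<Psi> x0 - mat 1) *v \<nu> x0 \<noteq> 0"
  then have "\<And>k. Ck_closure k \<Omega> \<Psi>" by (simp add: diffeo_on_closure_def Cinf_closure_def)
  then have cont: "continuous_on (closure \<Omega>) \<Psi>" and \<Psi>: "\<And>k. Ck_on k \<Omega> \<Psi>"
    and "\<forall>ks. \<exists>g. continuous_on (closure \<Omega>) g \<and> (\<forall>x\<in>\<Omega>. g x = iter_partial ks \<Psi> x)"
    unfolding Ck_closure_def by blast+
  from choice[OF this(3)] obtain g where g: "\<And>ks.
       continuous_on (closure \<Omega>) (g ks) \<and> (\<forall>x\<in>\<Omega>. g ks x = iter_partial ks \<Psi> x)"
    by blast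
  obtain U e \<phi> V where G: "local_subgraph \<Omega> U e \<phi>" and V: "open V" "V \<subseteq> U" "x0 \<in> V"
    and \<phi>: "\<And>k. Ck_grad (Suc k) V \<phi>"
    by (rule boundary_graph_Ck_grad[OF assms(6,5) _ x0 nz cont, where N=UNIV and g=g])
      (use assms(8) g \<Psi> in auto)
  have "Cinf_on V \<phi>"
    unfolding Cinf_on_def using Ck_grad_imp_Ck_on[OF V(1) Ck_grad_SucD[OF \<phi>]] by blast
  with nreg V show False using local_subgraph.boundary_regular_nearI[OF G] by blast
next
  fix x0
  assume "diffeo_on_closure real_analytic_closure \<Omega> \<Psi>" and x0: "x0 \<in> frontier \<Omega>"
    and nreg: "\<not> boundary_regular_near real_analytic_on \<Omega> x0"
    and nz: "(closure_jacobian \<Omega> \<Psi> x0 - mat 1) *v \<nu> x0 \<noteq> 0"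
  then have "boundary_regular_near real_analytic_on \<Omega> x0"
    by (intro boundary_graph_analytic[OF assms(6) _ x0 nz])
      (use assms(8) in \<open>auto simp: diffeo_on_closure_def\<close>)
  with nreg show False ..
qed

end
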